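(* Let $\hbar>0$, $n\in\mathbb{N}$, and let $f\in L^2(\mathbb{R}^n)$ with Wigner function $Wf$ on $\mathbb{R}^{2n}$. Suppose the negative part $\mathcal{N}_-(Wf)=\{z\in\mathbb{R}^{2n}:Wf(z)<0\}$ is nonempty and $\mathcal{N}_-(Wf)\subset B_{R_0}(z_0)$ for some $R_0>0$ and $z_0\in\mathbb{R}^{2n}$, where $B_{R_0}(z_0)$ is the ball of radius $R_0$ centered at $z_0$. Then $$R_0\geq\frac12\sqrt{\frac{\hbar}{2}\sqrt[n]{\frac{n!}{2}}}.$$
   Context: For $f\in L^2(\mathbb{R}^n)$, the Wigner function is $Wf(x,p)=\frac{1}{(2\pi\hbar)^n}\int_{\mathbb{R}^n} f(x+\tau/2)\overline{f(x-\tau/2)}e^{-\frac{i}{\hbar}p\cdot\tau}\,d\tau$, $(x,p)\in\mathbb{R}^{2n}$. *)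

theory Defs
  imports "HOL-Analysis.Analysis"
begin

definition L2 :: "(real^'n \<Rightarrow> complex) set" where
  "L2 = {f. f \<in> borel_measurable lborel \<and> integrable lborel (\<lambda>x. (cmod (f x))\<^sup>2)}"

definition wigner :: "real \<Rightarrow> (real^'n \<Rightarrow> complex) \<Rightarrow> (real^'n) \<times> (real^'n) \<Rightarrow> complex" where
  "wigner hbar f = (\<lambda>(x, p).
     complex_of_real (1 / (2 * pi * hbar) ^ CARD('n)) *
     (LINT \<tau>|lborel. f (x + (1/2) *\<^sub>R \<tau>) * cnj (f (x - (1/2) *\<^sub>R \<tau>))
                     * exp (- \<i> * complex_of_real ((p \<bullet> \<tau>) / hbar))))"

text \<open>Negative part of the (real-valued) Wigner function.\<close>
definition neg_part :: "((real^'n) \<times> (real^'n) \<Rightarrow> complex) \<Rightarrow> ((real^'n) \<times> (real^'n)) set" where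
  "neg_part W = {z. Re (W z) < 0}"

end

theory Submission
  imports Defs "HOL-Probability.Characteristic_Functions"
begin

text \<open>
  Write \<open>\<Pi>\<^sub>z\<close> for the reflection of a function in the phase-space point \<open>z\<close>. Up to a positive factor and the
  rescaling \<open>q = 2 p / hbar\<close> the Wigner function of \<open>f\<close> is the continuous real function
  \<open>A z = \<langle>\<Pi>\<^sub>z f, f\<rangle>\<close>. The product of the reflections in \<open>a\<close>, \<open>v\<close> and \<open>b\<close> is, up to a phase, the reflection in
  \<open>a + b - v\<close>, so Moyal's identity for the pairs \<open>f, f\<close> and \<open>\<Pi>\<^sub>a f, \<Pi>\<^sub>b f\<close> reads
  \<open>\<pi>\<^sup>n A a A b = \<integral> A v A (a + b - v) e\<^sup>i\<^sup>\<phi>\<^sup>(\<^sup>v\<^sup>) dv\<close> with a real \<open>\<phi>\<close> that vanishes for \<open>a = b\<close>.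

  Choose \<open>a\<close> and \<open>b\<close> outside the zero set of \<open>A\<close> whose midpoint \<open>m\<close> is a zero, and put \<open>G v = A v A (2 m - v)\<close>.
  Then \<open>\<integral> G = \<pi>\<^sup>n (A m)\<^sup>2 = 0\<close> and \<open>\<pi>\<^sup>n \<bar>G v\<bar> \<le> \<integral> \<bar>G\<bar>\<close> for all \<open>v\<close>, so that, as in the uncertainty
  principle of Bourgain, Clozel and Kahane,
  \<open>\<integral> \<bar>G\<bar> = \<integral> (\<bar>G\<bar> - G) \<le> 2 \<mu>(G < 0) sup \<bar>G\<bar> \<le> 2 \<pi>\<^sup>-\<^sup>n \<mu>(G < 0) \<integral> \<bar>G\<bar>\<close>.
  Hence \<open>\<pi>\<^sup>n / 2 \<le> \<mu>(G < 0) \<le> 2 \<mu>(A < 0)\<close>; comparing with the volume of the ball gives the bound on the radius.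

  Such \<open>a\<close> and \<open>b\<close> exist because \<open>A\<close> also takes positive values: its integral against the (positive) Wigner
  function of a Gaussian is nonnegative, again by Moyal's identity.
\<close>

section \<open>Affine substitutions in Lebesgue integrals\<close>

lemma nn_integral_lborel_affine:
  fixes c :: real and t :: "'a::euclidean_space"
  assumes [measurable]: "h \<in> borel_measurable borel" and c: "c \<noteq> 0"
  shows "(\<integral>\<^sup>+x. h x \<partial>lborel) = \<bar>c\<bar> ^ DIM('a) * (\<integral>\<^sup>+x. h (t + c *\<^sub>R x) \<partial>lborel)"
  by (subst lborel_affine[OF c, of t])
     (simp add: nn_integral_density nn_integral_distr nn_integral_cmult)

lemma integrable_lborel_affine:
  fixes h :: "'a::euclidean_space \<Rightarrow> 'b::{banach, second_countable_topology}"
  assumes h: "integrable lborel h" and c: "c \<noteq> 0"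
  shows "integrable lborel (\<lambda>x. h (t + c *\<^sub>R x))"
proof -
  have [measurable]: "h \<in> borel_measurable borel"
    using borel_measurable_integrable[OF h] by simp
  have "(\<integral>\<^sup>+x. norm (h x) \<partial>lborel) < \<infinity>"
    using h by (simp add: integrable_iff_bounded)
  then have "(\<integral>\<^sup>+x. norm (h (t + c *\<^sub>R x)) \<partial>lborel) < \<infinity>"
    using c by (subst (asm) nn_integral_lborel_affine[where c=c and t=t]) (auto simp: ennreal_mult_less_top)
  then show ?thesis
    by (auto simp: integrable_iff_bounded)
qed

lemma integrable_lborel_affine_iff:
  fixes h :: "'a::euclidean_space \<Rightarrow> 'b::{banach, second_countable_topology}"
  assumes c: "c \<noteq> 0"
  shows "integrable lborel (\<lambda>x. h (t + c *\<^sub>R x)) \<longleftrightarrow> integrable lborel h"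
proof
  assume "integrable lborel (\<lambda>x. h (t + c *\<^sub>R x))"
  from integrable_lborel_affine[OF this, of "1/c" "-(1/c) *\<^sub>R t"] c
  show "integrable lborel h" by (simp add: algebra_simps)
qed (simp add: integrable_lborel_affine c)

lemma integral_lborel_affine:
  fixes h :: "'a::euclidean_space \<Rightarrow> 'b::{banach, second_countable_topology}"
  assumes c: "c \<noteq> 0"
  shows "(\<integral>x. h x \<partial>lborel) = \<bar>c\<bar> ^ DIM('a) *\<^sub>R (\<integral>x. h (t + c *\<^sub>R x) \<partial>lborel)"
proof (cases "integrable lborel h")
  case True
  then have [measurable]: "h \<in> borel_measurable borel"
    using borel_measurable_integrable by fastforce
  show ?thesis
    using c by (subst lborel_affine[OF c, of t]) (simp add: integral_density integral_distr)
next
  case False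
  with c show ?thesis
    by (simp add: integrable_lborel_affine_iff not_integrable_integral_eq)
qed

lemma integral_lborel_translate:
  fixes h :: "'a::euclidean_space \<Rightarrow> 'b::{banach, second_countable_topology}"
  shows "(\<integral>x. h (t + x) \<partial>lborel) = (\<integral>x. h x \<partial>lborel)"
  using integral_lborel_affine[of 1 h t] by simp

lemma integral_lborel_reflect:
  fixes h :: "'a::euclidean_space \<Rightarrow> 'b::{banach, second_countable_topology}"
  shows "(\<integral>x. h (t - x) \<partial>lborel) = (\<integral>x. h x \<partial>lborel)"
  using integral_lborel_affine[of "-1" h t] by simp

section \<open>Square-integrable functions\<close>

definition square_integrable :: "('a::euclidean_space \<Rightarrow> complex) \<Rightarrow> bool" where
  "square_integrable f \<longleftrightarrow> f \<in> borel_measurable borel \<and> integrable lborel (\<lambda>x. (cmod (f x))\<^sup>2)"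

definition l2_norm :: "('a::euclidean_space \<Rightarrow> complex) \<Rightarrow> real" where
  "l2_norm f = sqrt (LINT x|lborel. (cmod (f x))\<^sup>2)"

definition l2_inner :: "('a::euclidean_space \<Rightarrow> complex) \<Rightarrow> ('a \<Rightarrow> complex) \<Rightarrow> complex" where
  "l2_inner f g = (LINT x|lborel. f x * cnj (g x))"

lemma borel_measurable_square_integrable [measurable_dest]:
  "square_integrable f \<Longrightarrow> f \<in> borel_measurable borel"
  by (simp add: square_integrable_def)

lemma integrable_cmod_square: "square_integrable f \<Longrightarrow> integrable lborel (\<lambda>x. (cmod (f x))\<^sup>2)"
  by (simp add: square_integrable_def)

lemma l2_norm_nonneg [simp]: "0 \<le> l2_norm f"
  by (simp add: l2_norm_def)

lemma l2_norm_square: "(l2_norm f)\<^sup>2 = (LINT x|lborel. (cmod (f x))\<^sup>2)"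
  by (simp add: l2_norm_def)

lemma l2_inner_self: "l2_inner f f = of_real ((l2_norm f)\<^sup>2)"
  unfolding l2_inner_def l2_norm_square integral_complex_of_real[symmetric]
  by (simp only: complex_norm_square)

lemma square_integrable_bound:
  assumes "integrable lborel h" "f \<in> borel_measurable borel" "\<And>x. (cmod (f x))\<^sup>2 \<le> h x"
  shows "square_integrable f"
  unfolding square_integrable_def
  using assms by (auto intro!: Bochner_Integration.integrable_bound[OF assms(1)] AE_I2 order_trans[OF _ abs_ge_self])

lemma norm_add_square_le:
  fixes a b :: "'a::real_normed_vector"
  shows "(norm (a + b))\<^sup>2 \<le> (norm a)\<^sup>2 + (norm b)\<^sup>2 + 2 * (norm a * norm b)"
  using power_mono[OF norm_triangle_ineq[of a b] norm_ge_zero, of 2] by (simp add: power2_sum)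

lemma square_integrable_add:
  assumes f: "square_integrable f" and g: "square_integrable g"
  shows "square_integrable (\<lambda>x. f x + g x)"
proof (rule square_integrable_bound)
  show "integrable lborel (\<lambda>x. 2 * (cmod (f x))\<^sup>2 + 2 * (cmod (g x))\<^sup>2)"
    using f g by (simp add: integrable_cmod_square)
  show "(\<lambda>x. f x + g x) \<in> borel_measurable borel"
    using f g by measurable
  show "(cmod (f x + g x))\<^sup>2 \<le> 2 * (cmod (f x))\<^sup>2 + 2 * (cmod (g x))\<^sup>2" for x
    using norm_add_square_le[of "f x" "g x"] sum_squares_bound[of "cmod (f x)" "cmod (g x)"] by simp
qed

lemma square_integrable_diff:
  assumes "square_integrable f" "square_integrable g"
  shows "square_integrable (\<lambda>x. f x - g x)"
  using square_integrable_add[OF assms(1), of "\<lambda>x. - g x"] assms(2)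
  by (simp add: square_integrable_def)

lemma borel_measurable_cnj [measurable (raw)]:
  "h \<in> borel_measurable M \<Longrightarrow> (\<lambda>x. cnj (h x)) \<in> borel_measurable M"
  by (rule borel_measurable_continuous_on) (intro continuous_intros)

lemma borel_measurable_cis [measurable (raw)]:
  "h \<in> borel_measurable M \<Longrightarrow> (\<lambda>x. cis (h x)) \<in> borel_measurable M"
  by (rule borel_measurable_continuous_on) (intro continuous_intros)

lemma square_integrable_cnj: "square_integrable f \<Longrightarrow> square_integrable (\<lambda>x. cnj (f x))"
  by (simp add: square_integrable_def borel_measurable_cnj)

lemma square_integrable_affine:
  assumes "square_integrable f" "c \<noteq> 0"
  shows "square_integrable (\<lambda>x. f (t + c *\<^sub>R x))"
  using assms integrable_lborel_affine[of "\<lambda>x. (cmod (f x))\<^sup>2" c t] by (auto simp: square_integrable_def)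

lemma square_integrable_translate: "square_integrable f \<Longrightarrow> square_integrable (\<lambda>x. f (t + x))"
  using square_integrable_affine[of f 1 t] by simp

lemma square_integrable_reflect: "square_integrable f \<Longrightarrow> square_integrable (\<lambda>x. f (t - x))"
  using square_integrable_affine[of f "-1" t] by simp

lemma l2_norm_translate: "l2_norm (\<lambda>x. f (t + x)) = l2_norm f"
  unfolding l2_norm_def by (simp add: integral_lborel_translate[of "\<lambda>x. (cmod (f x))\<^sup>2"])

lemma l2_norm_reflect: "l2_norm (\<lambda>x. f (t - x)) = l2_norm f"
  unfolding l2_norm_def by (simp add: integral_lborel_reflect[of "\<lambda>x. (cmod (f x))\<^sup>2"])

lemma
  fixes f g :: "'a \<Rightarrow> 'b::{real_normed_div_algebra, banach, second_countable_topology}"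
  assumes [measurable]: "f \<in> borel_measurable M" "g \<in> borel_measurable M"
    and f: "integrable M (\<lambda>x. (norm (f x))\<^sup>2)" and g: "integrable M (\<lambda>x. (norm (g x))\<^sup>2)"
  shows Cauchy_Schwarz_integrable: "integrable M (\<lambda>x. f x * g x)"
    and Cauchy_Schwarz_integral: "(LINT x|M. norm (f x * g x))
      \<le> sqrt (LINT x|M. (norm (f x))\<^sup>2) * sqrt (LINT x|M. (norm (g x))\<^sup>2)"
proof -
  let ?F = "LINT x|M. (norm (f x))\<^sup>2" and ?G = "LINT x|M. (norm (g x))\<^sup>2"
  have nn_square: "(\<integral>\<^sup>+x. ennreal (norm (h x)) ^ 2 \<partial>M) = ennreal (LINT x|M. (norm (h x))\<^sup>2)"
    if "integrable M (\<lambda>x. (norm (h x))\<^sup>2)" for h :: "'a \<Rightarrow> 'b"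
    using that by (subst nn_integral_eq_integral[symmetric]) (simp_all add: ennreal_power)
  have "(\<integral>\<^sup>+x. norm (f x * g x) \<partial>M)\<^sup>2 = (\<integral>\<^sup>+x. ennreal (norm (f x)) * ennreal (norm (g x)) \<partial>M)\<^sup>2"
    by (simp add: norm_mult ennreal_mult)
  also have "\<dots> \<le> (\<integral>\<^sup>+x. ennreal (norm (f x)) ^ 2 \<partial>M) * (\<integral>\<^sup>+x. ennreal (norm (g x)) ^ 2 \<partial>M)"
    by (intro Cauchy_Schwarz_nn_integral) measurable
  also have "\<dots> = ennreal (?F * ?G)"
    by (simp add: nn_square f g ennreal_mult)
  finally have square_le: "(\<integral>\<^sup>+x. norm (f x * g x) \<partial>M)\<^sup>2 \<le> ennreal (?F * ?G)" .
  then have "(\<integral>\<^sup>+x. norm (f x * g x) \<partial>M)\<^sup>2 < \<infinity>"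
    by (rule le_less_trans) simp
  then show fg: "integrable M (\<lambda>x. f x * g x)"
    by (intro integrableI_bounded) (simp_all add: power_less_top_ennreal)
  have "ennreal ((LINT x|M. norm (f x * g x))\<^sup>2) \<le> ennreal (?F * ?G)"
    using square_le nn_integral_eq_integral[OF integrable_norm[OF fg]] by (simp flip: ennreal_power)
  then have "(LINT x|M. norm (f x * g x))\<^sup>2 \<le> ?F * ?G"
    by (simp add: ennreal_le_iff)
  then show "(LINT x|M. norm (f x * g x)) \<le> sqrt ?F * sqrt ?G"
    unfolding real_sqrt_mult[symmetric] by (rule real_le_rsqrt)
qed

lemma integrable_mult_square_integrable:
  "square_integrable f \<Longrightarrow> square_integrable g \<Longrightarrow> integrable lborel (\<lambda>x. f x * g x)"
  by (intro Cauchy_Schwarz_integrable) (simp_all add: square_integrable_def)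

lemma cnj_l2_inner: "cnj (l2_inner f g) = l2_inner g f"
  unfolding l2_inner_def Bochner_Integration.integral_cnj[symmetric] by (simp add: mult.commute)

lemma integrable_l2_inner:
  "square_integrable f \<Longrightarrow> square_integrable g \<Longrightarrow> integrable lborel (\<lambda>x. f x * cnj (g x))"
  by (intro integrable_mult_square_integrable square_integrable_cnj)

lemma Cauchy_Schwarz_l2:
  "square_integrable f \<Longrightarrow> square_integrable g \<Longrightarrow> (LINT x|lborel. cmod (f x * g x)) \<le> l2_norm f * l2_norm g"
  unfolding l2_norm_def by (intro Cauchy_Schwarz_integral) (simp_all add: square_integrable_def)

lemma norm_l2_inner_le:
  assumes "square_integrable f" "square_integrable g"
  shows "cmod (l2_inner f g) \<le> l2_norm f * l2_norm g"
proof -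
  have "cmod (l2_inner f g) \<le> (LINT x|lborel. cmod (f x * g x))"
    unfolding l2_inner_def using integral_norm_bound[of lborel "\<lambda>x. f x * cnj (g x)"] by (simp add: norm_mult)
  also have "\<dots> \<le> l2_norm f * l2_norm g"
    by (rule Cauchy_Schwarz_l2[OF assms])
  finally show ?thesis .
qed

lemma l2_norm_add_le:
  assumes f: "square_integrable f" and g: "square_integrable g"
  shows "l2_norm (\<lambda>x. f x + g x) \<le> l2_norm f + l2_norm g"
proof (rule power2_le_imp_le)
  note integrable = integrable_cmod_square[OF f] integrable_cmod_square[OF g]
    integrable_norm[OF integrable_mult_square_integrable[OF f g]]
  have "(l2_norm (\<lambda>x. f x + g x))\<^sup>2
    \<le> (LINT x|lborel. (cmod (f x))\<^sup>2 + (cmod (g x))\<^sup>2 + 2 * cmod (f x * g x))"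
    unfolding l2_norm_square
  proof (rule integral_mono)
    show "integrable lborel (\<lambda>x. (cmod (f x + g x))\<^sup>2)"
      by (intro integrable_cmod_square square_integrable_add f g)
    show "integrable lborel (\<lambda>x. (cmod (f x))\<^sup>2 + (cmod (g x))\<^sup>2 + 2 * cmod (f x * g x))"
      by (intro Bochner_Integration.integrable_add integrable_mult_right integrable)
    show "(cmod (f x + g x))\<^sup>2 \<le> (cmod (f x))\<^sup>2 + (cmod (g x))\<^sup>2 + 2 * cmod (f x * g x)" for x
      using norm_add_square_le[of "f x" "g x"] by (simp add: norm_mult)
  qed
  also have "\<dots> = (l2_norm f)\<^sup>2 + (l2_norm g)\<^sup>2 + 2 * (LINT x|lborel. cmod (f x * g x))"
    using integrable by (simp add: l2_norm_square)
  also have "\<dots> \<le> (l2_norm f + l2_norm g)\<^sup>2"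
    using Cauchy_Schwarz_l2[OF f g] by (simp add: power2_sum)
  finally show "(l2_norm (\<lambda>x. f x + g x))\<^sup>2 \<le> (l2_norm f + l2_norm g)\<^sup>2" .
qed simp

lemma l2_dominated_approx:
  assumes [measurable]: "f \<in> borel_measurable borel" "\<And>n. F n \<in> borel_measurable borel"
    and w: "integrable lborel (\<lambda>x. (w x)\<^sup>2)" and bound: "\<And>n x. cmod (f x - F n x) \<le> w x"
    and lim: "AE x in lborel. (\<lambda>n. F n x) \<longlonglongrightarrow> f x" and e: "e > 0"
  obtains n where "l2_norm (\<lambda>x. f x - F n x) < e"
proof -
  have "(\<lambda>n. LINT x|lborel. (cmod (f x - F n x))\<^sup>2) \<longlonglongrightarrow> (LINT x|(lborel :: 'a measure). 0)"
  proof (rule integral_dominated_convergence[OF _ _ w])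
    show "AE x in lborel. (\<lambda>n. (cmod (f x - F n x))\<^sup>2) \<longlonglongrightarrow> 0"
      using lim
    proof eventually_elim
      case (elim x)
      then have "(\<lambda>n. (cmod (f x - F n x))\<^sup>2) \<longlonglongrightarrow> (cmod (f x - f x))\<^sup>2"
        by (intro tendsto_intros)
      then show ?case by simp
    qed
    show "AE x in lborel. norm ((cmod (f x - F n x))\<^sup>2) \<le> (w x)\<^sup>2" for n
      using bound by (intro AE_I2) (simp add: power_mono)
  qed measurable
  from tendsto_real_sqrt[OF this] have "(\<lambda>n. l2_norm (\<lambda>x. f x - F n x)) \<longlonglongrightarrow> 0"
    by (simp add: l2_norm_def)
  then show thesis
    using order_tendstoD(2)[OF _ e] eventually_happens'[OF sequentially_bot] that by blast
qed

section \<open>Density of continuous functions of bounded support\<close>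

lemma integrable_indicator_cball: "integrable lborel (indicator (cball (a::'a::euclidean_space) r) :: 'a \<Rightarrow> real)"
  by (intro integrable_real_indicator emeasure_bounded_finite) auto

lemma square_integrable_bounded_support:
  fixes f :: "'a::euclidean_space \<Rightarrow> complex"
  assumes "f \<in> borel_measurable borel" "\<And>x. cmod (f x) \<le> B" "\<And>x. norm x > r \<Longrightarrow> f x = 0"
  shows "square_integrable f"
proof (rule square_integrable_bound)
  show "integrable lborel (\<lambda>x::'a. B\<^sup>2 * indicator (cball 0 r) x)"
    by (intro integrable_mult_right integrable_indicator_cball)
  show "(cmod (f x))\<^sup>2 \<le> B\<^sup>2 * indicator (cball 0 r) x" for x
    using assms(2,3)[of x] by (auto simp: indicator_def intro!: power_mono)
qed (rule assms)

lemma square_integrable_truncation_approx: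
  fixes f :: "'a::euclidean_space \<Rightarrow> complex"
  assumes f: "square_integrable f" and e: "e > 0"
  obtains F B where "F \<in> borel_measurable borel" "\<And>x. cmod (F x) \<le> B" "\<And>x. norm x > B \<Longrightarrow> F x = 0"
    "l2_norm (\<lambda>x. f x - F x) < e"
proof -
  have [measurable]: "f \<in> borel_measurable borel" using f by measurable
  define F where "F n x = (if norm x \<le> real n \<and> cmod (f x) \<le> real n then f x else 0)" for n x
  have [measurable]: "F n \<in> borel_measurable borel" for n
    unfolding F_def by measurable
  have lim: "AE x in lborel. (\<lambda>n. F n x) \<longlonglongrightarrow> f x"
  proof (rule AE_I2)
    fix x
    obtain m :: nat where "max (norm x) (cmod (f x)) < m" using reals_Archimedean2 by blast
    then have "F n x = f x" if "n \<ge> m" for n using that by (simp add: F_def)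
    then show "(\<lambda>n. F n x) \<longlonglongrightarrow> f x"
      by (intro tendsto_eventually eventually_sequentiallyI[of m])
  qed
  obtain n where "l2_norm (\<lambda>x. f x - F n x) < e"
    by (rule l2_dominated_approx[OF _ _ integrable_cmod_square[OF f] _ lim e]) (auto simp: F_def)
  then show thesis
    by (intro that[of "F n" "real n"]) (auto simp: F_def)
qed

lemma bounded_measurable_AE_lim_continuous:
  fixes f :: "'a::euclidean_space \<Rightarrow> 'b::euclidean_space"
  assumes [measurable]: "f \<in> borel_measurable borel" and B: "\<And>x. norm (f x) \<le> B"
  obtains g where "\<And>n. continuous_on UNIV (g n)" "\<And>n x. norm (g n x) \<le> B"
    "AE x in lborel. (\<lambda>n. g n x) \<longlonglongrightarrow> f x"
proof -
  have "f measurable_on UNIV"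
    by (intro lebesgue_measurable_imp_measurable_on measurable_completion) simp_all
  then obtain N g where N: "negligible N" and g: "\<And>n. continuous_on UNIV (g n)"
    and lim: "\<And>x. x \<notin> N \<Longrightarrow> (\<lambda>n. g n x) \<longlonglongrightarrow> f x"
    unfolding measurable_on_def by auto
  let ?P = "closest_point (cball (0::'b) B)"
  have "0 \<le> B" using B[of 0] norm_ge_zero order_trans by blast
  then have P_cont: "continuous_on UNIV ?P" and P_le: "norm (?P w) \<le> B" for w
    using closest_point_in_set[of "cball 0 B" w] by (auto intro: continuous_on_closest_point)
  have P_f: "?P (f x) = f x" for x
    using B by (simp add: closest_point_self)
  have "AE x in lebesgue. x \<notin> N"
    using N by (intro AE_not_in) (simp add: negligible_iff_null_sets)
  then have "AE x in lborel. x \<notin> N"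
    by (simp add: AE_completion_iff)
  then have "AE x in lborel. (\<lambda>n. ?P (g n x)) \<longlonglongrightarrow> f x"
  proof eventually_elim
    case (elim x)
    then have "(\<lambda>n. ?P (g n x)) \<longlonglongrightarrow> ?P (f x)"
      by (intro continuous_on_tendsto_compose[OF P_cont] lim) auto
    then show ?case by (simp only: P_f)
  qed
  moreover have "continuous_on UNIV (\<lambda>x. ?P (g n x))" for n
    by (rule continuous_on_compose2[OF P_cont g]) simp
  ultimately show thesis
    using P_le by (intro that[of "\<lambda>n x. ?P (g n x)"])
qed

lemma bounded_support_AE_lim_continuous:
  fixes f :: "'a::euclidean_space \<Rightarrow> 'b::euclidean_space"
  assumes f: "f \<in> borel_measurable borel" and B: "\<And>x. norm (f x) \<le> B" and r: "\<And>x. norm x > r \<Longrightarrow> f x = 0"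
  obtains F where "\<And>n. continuous_on UNIV (F n)" "\<And>n x. norm (F n x) \<le> B"
    "\<And>n x. norm x > r + 1 \<Longrightarrow> F n x = 0" "AE x in lborel. (\<lambda>n. F n x) \<longlonglongrightarrow> f x"
proof -
  obtain g where g: "\<And>n. continuous_on UNIV (g n)" and g_le: "\<And>n x. norm (g n x) \<le> B"
    and lim: "AE x in lborel. (\<lambda>n. g n x) \<longlonglongrightarrow> f x"
    using bounded_measurable_AE_lim_continuous[OF f B] by blast
  define cutoff where "cutoff x = min 1 (max 0 (r + 1 - norm x))" for x :: 'a
  define F where "F n x = cutoff x *\<^sub>R g n x" for n x
  have cutoff_f: "cutoff x *\<^sub>R f x = f x" for x
    using r[of x] by (cases "norm x \<le> r") (auto simp: cutoff_def)
  have F_le: "norm (F n x) \<le> B" for n x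
  proof -
    have "cutoff x * norm (g n x) \<le> norm (g n x)"
      by (intro mult_left_le_one_le) (simp_all add: cutoff_def)
    with g_le[of n x] show ?thesis by (simp add: F_def cutoff_def)
  qed
  have F_lim: "AE x in lborel. (\<lambda>n. F n x) \<longlonglongrightarrow> f x"
    using lim
  proof eventually_elim
    case (elim x)
    then have "(\<lambda>n. F n x) \<longlonglongrightarrow> cutoff x *\<^sub>R f x"
      unfolding F_def by (intro tendsto_intros)
    then show ?case by (simp only: cutoff_f)
  qed
  have "continuous_on UNIV (F n)" for n
    unfolding F_def cutoff_def by (intro continuous_intros g)
  with F_le F_lim show thesis
    by (intro that[of F]) (simp_all add: F_def cutoff_def)
qed

lemma continuous_approx_if_bounded_support:
  fixes f :: "'a::euclidean_space \<Rightarrow> complex"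
  assumes f [measurable]: "f \<in> borel_measurable borel"
    and B: "\<And>x. cmod (f x) \<le> B" and r: "\<And>x. norm x > r \<Longrightarrow> f x = 0" and e: "e > 0"
  obtains F where "continuous_on UNIV F" "\<And>x. norm x > r + 1 \<Longrightarrow> F x = 0" "l2_norm (\<lambda>x. f x - F x) < e"
proof -
  obtain F where F: "\<And>n. continuous_on UNIV (F n)" and F_le: "\<And>n x. cmod (F n x) \<le> B"
    and F_0: "\<And>n x. norm x > r + 1 \<Longrightarrow> F n x = 0" and lim: "AE x in lborel. (\<lambda>n. F n x) \<longlonglongrightarrow> f x"
    using bounded_support_AE_lim_continuous[OF f B r] by blast
  have [measurable]: "F n \<in> borel_measurable borel" for n
    by (rule borel_measurable_continuous_onI[OF F])
  obtain n where "l2_norm (\<lambda>x. f x - F n x) < e"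
  proof (rule l2_dominated_approx[OF _ _ _ _ lim e])
    show "integrable lborel (\<lambda>x::'a. (2 * B * indicator (cball 0 (r + 1)) x)\<^sup>2)"
      unfolding power_mult_distrib
      by (intro integrable_mult_right) (simp add: power2_eq_square integrable_indicator_cball flip: indicator_inter_arith)
    show "cmod (f x - F n x) \<le> 2 * B * indicator (cball 0 (r + 1)) x" for n x
      using norm_triangle_ineq4[of "f x" "F n x"] B[of x] F_le[of n x] F_0[of x n] r[of x]
      by (cases "norm x \<le> r + 1") auto
  qed auto
  then show thesis
    using that[of "F n"] F F_0 by blast
qed

lemma square_integrable_continuous_bounded_support:
  fixes F :: "'a::euclidean_space \<Rightarrow> complex"
  assumes F: "continuous_on UNIV F" and r: "\<And>x. norm x > r \<Longrightarrow> F x = 0"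
  obtains B where "\<And>x. cmod (F x) \<le> B" "square_integrable F"
proof -
  have "bounded (F ` cball 0 r)"
    using F by (intro compact_imp_bounded compact_continuous_image) (auto intro: continuous_on_subset)
  then obtain B where "B > 0" and B_cball: "\<And>x. x \<in> cball 0 r \<Longrightarrow> cmod (F x) \<le> B"
    by (auto simp: bounded_pos)
  have B: "cmod (F x) \<le> B" for x
    using r[of x] B_cball[of x] \<open>B > 0\<close> by (cases "norm x \<le> r") auto
  show thesis
    by (rule that[OF B square_integrable_bounded_support[OF _ B r]])
       (use F in \<open>auto intro: borel_measurable_continuous_onI\<close>)
qed

theorem square_integrable_continuous_approx:
  fixes f :: "'a::euclidean_space \<Rightarrow> complex"
  assumes f: "square_integrable f" and e: "e > 0"
  obtains F r where "continuous_on UNIV F" "\<And>x. norm x > r \<Longrightarrow> F x = 0" "l2_norm (\<lambda>x. f x - F x) < e"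
proof -
  obtain T B where T: "T \<in> borel_measurable borel" "\<And>x. cmod (T x) \<le> B" "\<And>x. norm x > B \<Longrightarrow> T x = 0"
    and f_T: "l2_norm (\<lambda>x. f x - T x) < e / 2"
    using square_integrable_truncation_approx[OF f half_gt_zero[OF e]] by blast
  obtain F where F: "continuous_on UNIV F" "\<And>x. norm x > B + 1 \<Longrightarrow> F x = 0"
    and T_F: "l2_norm (\<lambda>x. T x - F x) < e / 2"
    using continuous_approx_if_bounded_support[OF T half_gt_zero[OF e]] by blast
  have "square_integrable T" by (rule square_integrable_bounded_support[OF T])
  moreover have "square_integrable F" using square_integrable_continuous_bounded_support[OF F] by blast
  ultimately have "l2_norm (\<lambda>x. (f x - T x) + (T x - F x)) \<le> l2_norm (\<lambda>x. f x - T x) + l2_norm (\<lambda>x. T x - F x)"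
    by (intro l2_norm_add_le square_integrable_diff f)
  with f_T T_F have "l2_norm (\<lambda>x. f x - F x) < e" by simp
  with F show thesis by (rule that)
qed

section \<open>The cross-Wigner function\<close>

definition fourier :: "('a::euclidean_space \<Rightarrow> complex) \<Rightarrow> 'a \<Rightarrow> complex" where
  "fourier h q = (LINT x|lborel. h x * cis (- (q \<bullet> x)))"

definition cross_wigner :: "('a::euclidean_space \<Rightarrow> complex) \<Rightarrow> ('a \<Rightarrow> complex) \<Rightarrow> 'a \<times> 'a \<Rightarrow> complex" where
  "cross_wigner f g = (\<lambda>(y, q). fourier (\<lambda>t. f (y + t) * cnj (g (y - t))) q)"

text \<open>The Grossmann--Royer operator: reflection in a point of phase space.\<close>

definition parity :: "'a \<times> 'a \<Rightarrow> ('a::euclidean_space \<Rightarrow> complex) \<Rightarrow> 'a \<Rightarrow> complex" where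
  "parity = (\<lambda>(y, q) f x. cis (q \<bullet> (x - y)) * f (2 *\<^sub>R y - x))"

lemma cross_wigner_eq_l2_inner: "cross_wigner f g z = l2_inner (parity z f) g"
proof -
  obtain y q where z: "z = (y, q)" by force
  have "l2_inner (parity z f) g = (LINT t|lborel. parity z f (y - t) * cnj (g (y - t)))"
    unfolding l2_inner_def by (rule integral_lborel_reflect[symmetric])
  also have "\<dots> = cross_wigner f g z"
    by (simp add: z cross_wigner_def fourier_def parity_def scaleR_2 mult_ac)
  finally show ?thesis by simp
qed

lemma square_integrable_parity:
  assumes "square_integrable f"
  shows "square_integrable (parity z f)"
proof -
  obtain y q where z: "z = (y, q)" by force
  note reflected = square_integrable_reflect[OF assms, of "2 *\<^sub>R y"]
  show ?thesis
    by (rule square_integrable_bound[OF integrable_cmod_square[OF reflected]])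
       (use borel_measurable_square_integrable[OF reflected] in \<open>auto simp: z parity_def norm_mult\<close>)
qed

lemma l2_norm_parity: "l2_norm (parity z f) = l2_norm f"
proof -
  obtain y q where z: "z = (y, q)" by force
  have "l2_norm (parity z f) = l2_norm (\<lambda>x. f (2 *\<^sub>R y - x))"
    by (simp add: z parity_def l2_norm_def norm_mult)
  then show ?thesis by (simp add: l2_norm_reflect)
qed

lemma norm_cross_wigner_le:
  assumes "square_integrable f" "square_integrable g"
  shows "cmod (cross_wigner f g z) \<le> l2_norm f * l2_norm g"
  using norm_l2_inner_le[OF square_integrable_parity[OF assms(1)] assms(2)]
  by (simp add: cross_wigner_eq_l2_inner l2_norm_parity)

lemma cross_wigner_diff_left:
  assumes "square_integrable f" "square_integrable f'" "square_integrable g"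
  shows "cross_wigner (\<lambda>x. f x - f' x) g z = cross_wigner f g z - cross_wigner f' g z"
proof -
  have "parity z (\<lambda>x. f x - f' x) = (\<lambda>x. parity z f x - parity z f' x)"
    by (auto simp: parity_def split_beta right_diff_distrib)
  then show ?thesis
    using integrable_l2_inner[OF square_integrable_parity assms(3)] assms(1,2)
    by (simp add: cross_wigner_eq_l2_inner l2_inner_def left_diff_distrib)
qed

lemma continuous_on_cross_wigner_if_bounded_support:
  fixes F :: "'a::euclidean_space \<Rightarrow> complex"
  assumes F: "continuous_on UNIV F" and r: "\<And>x. norm x > r \<Longrightarrow> F x = 0" and g: "square_integrable g"
  shows "continuous_on UNIV (cross_wigner F g)"
proof -
  obtain B where B: "\<And>x. cmod (F x) \<le> B" and F_l2: "square_integrable F"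
    using square_integrable_continuous_bounded_support[OF F r] by blast
  have B0: "0 \<le> B" using B[of 0] norm_ge_zero order_trans by blast
  have "(\<lambda>n. cross_wigner F g (z n)) \<longlonglongrightarrow> cross_wigner F g a" if z: "z \<longlonglongrightarrow> a" for z a
  proof -
    obtain S where S: "\<And>n. norm (fst (z n)) \<le> S"
      using convergent_imp_bounded[OF tendsto_fst[OF z]] by (auto simp: bounded_iff)
    let ?w = "\<lambda>x::'a. of_real (B * indicator (cball 0 (2 * S + r)) x) * cnj (g x)"
    have w: "integrable lborel (\<lambda>x. cmod (?w x))"
      using B0 by (intro integrable_norm integrable_l2_inner g
          square_integrable_bounded_support[where B=B and r="2 * S + r"]) (auto simp: indicator_def)
    have bound: "cmod (parity (z n) F x * cnj (g x)) \<le> cmod (?w x)" for n x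
    proof -
      have "cmod (F (2 *\<^sub>R fst (z n) - x)) \<le> B * indicator (cball 0 (2 * S + r)) x"
      proof (cases "norm x \<le> 2 * S + r")
        case False
        have "norm x \<le> norm (2 *\<^sub>R fst (z n)) + norm (2 *\<^sub>R fst (z n) - x)"
          by (metis norm_minus_commute norm_triangle_sub)
        with False S[of n] have "norm (2 *\<^sub>R fst (z n) - x) > r" by simp
        with r B0 show ?thesis by simp
      qed (use B in simp)
      then show ?thesis
        using B0 by (auto simp: parity_def split_beta norm_mult abs_mult intro!: mult_right_mono)
    qed
    have "(\<lambda>n. parity (z n) F x * cnj (g x)) \<longlonglongrightarrow> parity a F x * cnj (g x)" for x
      unfolding parity_def split_beta
      by (intro tendsto_intros continuous_on_tendsto_compose[OF F] tendsto_fst[OF z] tendsto_snd[OF z]) auto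
    then show ?thesis
      unfolding cross_wigner_eq_l2_inner l2_inner_def
      using bound integrable_l2_inner[OF square_integrable_parity[OF F_l2] g]
      by (intro integral_dominated_convergence[OF _ _ w]) auto
  qed
  then show ?thesis
    by (simp add: continuous_on_sequentially o_def)
qed

theorem continuous_on_cross_wigner:
  assumes f: "square_integrable f" and g: "square_integrable g"
  shows "continuous_on UNIV (cross_wigner f g)"
proof -
  have "\<forall>n. \<exists>F r. continuous_on UNIV F \<and> (\<forall>x. norm x > r \<longrightarrow> F x = 0)
      \<and> l2_norm (\<lambda>x. f x - F x) < inverse (real (Suc n))"
    using square_integrable_continuous_approx[OF f] by (metis inverse_positive_iff_positive of_nat_0_less_iff zero_less_Suc)
  then obtain F r where F: "\<And>n. continuous_on UNIV (F n)" "\<And>n x. norm x > r n \<Longrightarrow> F n x = 0"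
    and F_approx: "\<And>n. l2_norm (\<lambda>x. f x - F n x) < inverse (real (Suc n))"
    by metis
  have F_l2: "square_integrable (F n)" for n
    using square_integrable_continuous_bounded_support[OF F] by blast
  have dist_le: "dist (cross_wigner (F n) g z) (cross_wigner f g z) \<le> inverse (real (Suc n)) * l2_norm g" for n z
  proof -
    have "dist (cross_wigner (F n) g z) (cross_wigner f g z) = cmod (cross_wigner (\<lambda>x. f x - F n x) g z)"
      by (simp add: dist_commute dist_norm cross_wigner_diff_left[OF f F_l2 g])
    also have "\<dots> \<le> l2_norm (\<lambda>x. f x - F n x) * l2_norm g"
      by (intro norm_cross_wigner_le square_integrable_diff f F_l2 g)
    also have "\<dots> \<le> inverse (real (Suc n)) * l2_norm g"
      using F_approx[of n] by (intro mult_right_mono) simp_all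
    finally show ?thesis .
  qed
  have "(\<lambda>n. inverse (real (Suc n)) * l2_norm g) \<longlonglongrightarrow> 0"
    using tendsto_mult_left_zero[OF LIMSEQ_inverse_real_of_nat] .
  then have "uniform_limit UNIV (\<lambda>n. cross_wigner (F n) g) (cross_wigner f g) sequentially"
    using dist_le by (auto intro!: uniform_limitI elim!: eventually_mono dest!: order_tendstoD(2) intro: le_less_trans)
  then show ?thesis
    by (rule uniform_limit_theorem[rotated])
       (use continuous_on_cross_wigner_if_bounded_support[OF F g] in auto)
qed

lemma borel_measurable_cross_wigner:
  "square_integrable f \<Longrightarrow> square_integrable g \<Longrightarrow> cross_wigner f g \<in> borel_measurable borel"
  by (intro borel_measurable_continuous_onI continuous_on_cross_wigner)

lemma cnj_cross_wigner: "cnj (cross_wigner f g z) = cross_wigner g f z"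
proof -
  obtain y q where z: "z = (y, q)" by force
  have "cnj (cross_wigner f g z) = (LINT t|lborel. cnj (f (y + t) * cnj (g (y - t)) * cis (- (q \<bullet> t))))"
    unfolding z cross_wigner_def prod.case fourier_def by (rule Bochner_Integration.integral_cnj[symmetric])
  also have "\<dots> = (LINT t|lborel. g (y - t) * cnj (f (y + t)) * cis (q \<bullet> t))"
    by (simp add: cis_cnj mult_ac)
  also have "\<dots> = (LINT t|lborel. g (y - (0 - t)) * cnj (f (y + (0 - t))) * cis (q \<bullet> (0 - t)))"
    by (rule integral_lborel_reflect[symmetric])
  also have "\<dots> = cross_wigner g f z"
    by (simp add: z cross_wigner_def fourier_def)
  finally show ?thesis .
qed

definition symplectic_form :: "'a::real_inner \<times> 'a \<Rightarrow> 'a \<times> 'a \<Rightarrow> real" where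
  "symplectic_form a b = snd a \<bullet> fst b - fst a \<bullet> snd b"

lemma cross_wigner_parity:
  "cross_wigner (parity a f) (parity b g) v
    = cis (symplectic_form (a - b) v - symplectic_form a b) * cross_wigner f g (a + b - v)"
proof -
  obtain a1 a2 b1 b2 y q where coords: "a = (a1, a2)" "b = (b1, b2)" "v = (y, q)"
    by (metis surj_pair)
  let ?y = "a1 + b1 - y" and ?q = "a2 + b2 - q" and ?c = "cis (symplectic_form (a - b) v - symplectic_form a b)"
  let ?h = "\<lambda>t. parity a f (y + t) * cnj (parity b g (y - t)) * cis (- (q \<bullet> t))"
  have "?h (a1 - b1 - s) = ?c * (f (?y + s) * cnj (g (?y - s)) * cis (- (?q \<bullet> s)))" for s
  proof -
    let ?t = "a1 - b1 - s"
    have args: "2 *\<^sub>R a1 - (y + ?t) = ?y + s" "2 *\<^sub>R b1 - (y - ?t) = ?y - s"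
      by (simp_all add: scaleR_2)
    have "?h ?t = f (?y + s) * cnj (g (?y - s)) *
        (cis (a2 \<bullet> (y + ?t - a1)) * cis (- (b2 \<bullet> (y - ?t - b1))) * cis (- (q \<bullet> ?t)))"
      unfolding coords parity_def prod.case args complex_cnj_mult cis_cnj by (simp only: mult_ac)
    also have "cis (a2 \<bullet> (y + ?t - a1)) * cis (- (b2 \<bullet> (y - ?t - b1))) * cis (- (q \<bullet> ?t)) = ?c * cis (- (?q \<bullet> s))"
      unfolding cis_mult
      by (rule arg_cong[where f=cis]) (simp add: coords symplectic_form_def inner_simps inner_commute)
    finally show ?thesis by (simp add: mult_ac)
  qed
  then have shifted: "(LINT s|lborel. ?h (a1 - b1 - s)) = ?c * cross_wigner f g (a + b - v)"
    by (simp add: coords cross_wigner_def fourier_def)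
  have "cross_wigner (parity a f) (parity b g) v = (LINT t|lborel. ?h t)"
    by (simp add: coords cross_wigner_def fourier_def)
  also have "\<dots> = (LINT s|lborel. ?h (a1 - b1 - s))"
    by (rule integral_lborel_reflect[symmetric])
  finally show ?thesis unfolding shifted .
qed

section \<open>Fourier transforms of Gaussians\<close>

definition gauss :: "'a::euclidean_space \<Rightarrow> real" where
  "gauss x = exp (- (norm x)\<^sup>2 / 2)"

lemma gauss_pos [simp]: "0 < gauss x" and gauss_nonneg [simp]: "0 \<le> gauss x"
  and gauss_le_1 [simp]: "gauss x \<le> 1" and gauss_0 [simp]: "gauss 0 = 1"
  by (auto simp: gauss_def)

lemma continuous_on_gauss [continuous_intros]:
  "continuous_on A h \<Longrightarrow> continuous_on A (\<lambda>x. gauss (h x))"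
  unfolding gauss_def by (intro continuous_intros) auto

lemma borel_measurable_gauss [measurable]: "gauss \<in> borel_measurable borel"
  by (intro borel_measurable_continuous_onI continuous_intros)

lemma gauss_scaleR_tendsto_1:
  assumes "e \<longlonglongrightarrow> 0"
  shows "(\<lambda>n. gauss (e n *\<^sub>R x)) \<longlonglongrightarrow> 1"
proof -
  have "(\<lambda>n. gauss (e n *\<^sub>R x)) \<longlonglongrightarrow> exp (- (norm (0 *\<^sub>R x))\<^sup>2 / 2)"
    unfolding gauss_def by (intro tendsto_intros assms) auto
  then show ?thesis by simp
qed

lemma
  fixes t :: real
  shows integrable_gauss_cis_real: "integrable lborel (\<lambda>x::real. complex_of_real (exp (- x\<^sup>2 / 2)) * cis (- (t * x)))"
    and integral_gauss_cis_real: "(LINT x|lborel. complex_of_real (exp (- x\<^sup>2 / 2)) * cis (- (t * x)))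
      = complex_of_real (sqrt (2 * pi) * exp (- t\<^sup>2 / 2))"
proof -
  have density_eq: "complex_of_real (exp (- x\<^sup>2 / 2)) * cis (- (t * x))
    = sqrt (2 * pi) *\<^sub>R (std_normal_density x *\<^sub>R iexp (- t * x))" for x
    by (simp add: std_normal_density_def cis_conv_exp scaleR_conv_of_real mult_ac)
  have "integrable lborel (\<lambda>x. std_normal_density x *\<^sub>R iexp (- t * x))"
    by (rule Bochner_Integration.integrable_bound[OF integrable_normal_moment[of 1 0 0]]) auto
  then show "integrable lborel (\<lambda>x::real. complex_of_real (exp (- x\<^sup>2 / 2)) * cis (- (t * x)))"
    unfolding density_eq by (rule integrable_scaleR_right)
  have "(LINT x|lborel. std_normal_density x *\<^sub>R iexp (- t * x)) = char std_normal_distribution (- t)"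
    unfolding char_def by (subst integral_density) auto
  also have "\<dots> = complex_of_real (exp (- t\<^sup>2 / 2))"
    by (simp add: char_std_normal_distribution)
  finally show "(LINT x|lborel. complex_of_real (exp (- x\<^sup>2 / 2)) * cis (- (t * x)))
      = complex_of_real (sqrt (2 * pi) * exp (- t\<^sup>2 / 2))"
    unfolding density_eq by (simp add: scaleR_conv_of_real)
qed

lemma gauss_eq_prod: "gauss x = (\<Prod>b\<in>Basis. exp (- (x \<bullet> b)\<^sup>2 / 2))"
  unfolding gauss_def exp_sum[OF finite_Basis, symmetric] power2_norm_eq_inner euclidean_inner[of x x]
  by (simp add: sum_negf sum_divide_distrib power2_eq_square)

lemma cis_inner_eq_prod: "cis (- (v \<bullet> x)) = (\<Prod>b\<in>Basis. cis (- ((v \<bullet> b) * (x \<bullet> b))))"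
  unfolding cis_conv_exp exp_sum[OF finite_Basis, symmetric] euclidean_inner[of v x]
  by (simp add: sum_distrib_left sum_negf)

lemma
  fixes v :: "'a::euclidean_space"
  shows integrable_gauss_cis: "integrable lborel (\<lambda>x. complex_of_real (gauss x) * cis (- (v \<bullet> x)))"
    and fourier_gauss: "fourier (\<lambda>x. of_real (gauss x)) v = of_real (sqrt (2 * pi) ^ DIM('a) * gauss v)"
proof -
  interpret product_sigma_finite "\<lambda>_::'a. lborel :: real measure" by standard
  let ?h = "\<lambda>b x. complex_of_real (exp (- x\<^sup>2 / 2)) * cis (- ((v \<bullet> b) * x))"
  let ?T = "\<lambda>f. \<Sum>b\<in>Basis. f b *\<^sub>R b :: 'a"
  let ?G = "\<lambda>x. complex_of_real (gauss x) * cis (- (v \<bullet> x))"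
  have T: "?T \<in> measurable (Pi\<^sub>M Basis (\<lambda>_. lborel)) borel" by measurable
  have G_T: "?G (?T f) = (\<Prod>b\<in>Basis. ?h b (f b))" for f
    by (simp add: gauss_eq_prod cis_inner_eq_prod of_real_prod flip: prod.distrib)
  have "integrable (Pi\<^sub>M Basis (\<lambda>_. lborel)) (\<lambda>f. \<Prod>b\<in>(Basis::'a set). ?h b (f b))"
    by (intro product_integrable_prod integrable_gauss_cis_real) auto
  then show "integrable lborel ?G"
    by (subst lborel_eq, subst integrable_distr_eq[OF T]) (simp_all only: G_T, measurable)
  have "fourier (\<lambda>x. of_real (gauss x)) v = (LINT f|Pi\<^sub>M Basis (\<lambda>_. lborel). (\<Prod>b\<in>Basis. ?h b (f b)))"
    unfolding fourier_def by (subst lborel_eq, subst integral_distr[OF T]) (simp_all only: G_T, measurable)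
  also have "\<dots> = (\<Prod>b\<in>Basis. LINT x|lborel. ?h b x)"
    by (intro product_integral_prod integrable_gauss_cis_real) auto
  also have "\<dots> = of_real (sqrt (2 * pi) ^ DIM('a) * gauss v)"
    unfolding integral_gauss_cis_real by (simp add: prod.distrib gauss_eq_prod)
  finally show "fourier (\<lambda>x. of_real (gauss x)) v = of_real (sqrt (2 * pi) ^ DIM('a) * gauss v)" .
qed

lemma integrable_gauss: "integrable lborel (gauss :: 'a::euclidean_space \<Rightarrow> real)"
  using integrable_norm[OF integrable_gauss_cis[of "0::'a"]] by simp

lemma integral_gauss: "(LINT x|lborel. gauss (x::'a::euclidean_space)) = sqrt (2 * pi) ^ DIM('a)"
proof -
  have "complex_of_real (LINT x|lborel. gauss (x::'a)) = of_real (sqrt (2 * pi) ^ DIM('a))"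
    using fourier_gauss[of "0::'a"] by (simp add: fourier_def)
  then show ?thesis by (simp only: of_real_eq_iff)
qed

lemma integrable_gauss_scaleR:
  "e \<noteq> 0 \<Longrightarrow> integrable lborel (\<lambda>x::'a::euclidean_space. gauss (e *\<^sub>R x))"
  using integrable_lborel_affine[OF integrable_gauss, of e 0] by simp

lemma fourier_gauss_scaleR:
  fixes v :: "'a::euclidean_space"
  assumes e: "e > 0"
  shows "fourier (\<lambda>x. of_real (gauss (e *\<^sub>R x))) v = of_real ((sqrt (2 * pi) / e) ^ DIM('a) * gauss ((1 / e) *\<^sub>R v))"
proof -
  have "fourier (\<lambda>x. of_real (gauss (e *\<^sub>R x))) v = (1 / e) ^ DIM('a) *\<^sub>R fourier (\<lambda>x. of_real (gauss x)) ((1 / e) *\<^sub>R v)"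
    unfolding fourier_def using e by (subst integral_lborel_affine[where c="1/e" and t=0]) auto
  then show ?thesis
    by (simp add: fourier_gauss scaleR_conv_of_real power_divide)
qed

section \<open>Plancherel's theorem\<close>

lemma borel_measurable_fourier [measurable]:
  fixes h :: "'a::euclidean_space \<Rightarrow> complex"
  assumes [measurable]: "h \<in> borel_measurable borel"
  shows "fourier h \<in> borel_measurable borel"
proof -
  have "(\<lambda>(q, x). h x * cis (- (q \<bullet> x))) \<in> borel_measurable (lborel \<Otimes>\<^sub>M (lborel :: 'a measure))"
    by measurable
  from lborel.borel_measurable_lebesgue_integral[OF this] show ?thesis
    by (simp add: fourier_def[abs_def])
qed

lemma norm_fourier_le: "cmod (fourier h q) \<le> (LINT x|lborel. cmod (h x))"
  using integral_norm_bound[of lborel "\<lambda>x. h x * cis (- (q \<bullet> x))"] by (simp add: fourier_def norm_mult)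

lemma cnj_fourier: "cnj (fourier h q) = fourier (\<lambda>x. cnj (h (- x))) q"
proof -
  have "cnj (fourier h q) = (LINT x|lborel. cnj (h x * cis (- (q \<bullet> x))))"
    unfolding fourier_def by (rule Bochner_Integration.integral_cnj[symmetric])
  also have "\<dots> = (LINT x|lborel. cnj (h (0 - x) * cis (- (q \<bullet> (0 - x)))))"
    by (rule integral_lborel_reflect[symmetric])
  finally show ?thesis
    by (simp add: fourier_def cis_cnj)
qed

lemma fourier_multiplication_formula:
  fixes h k :: "'a::euclidean_space \<Rightarrow> complex"
  assumes h: "integrable lborel h" and k: "integrable lborel k"
  shows "(LINT q|lborel. fourier h q * k q) = (LINT x|lborel. h x * fourier k x)"
proof -
  have [measurable]: "h \<in> borel_measurable borel" "k \<in> borel_measurable borel"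
    using borel_measurable_integrable[OF h] borel_measurable_integrable[OF k] by simp_all
  have "integrable (lborel \<Otimes>\<^sub>M lborel) (\<lambda>(q, x). h x * k q * cis (- (q \<bullet> x)))"
  proof (rule lborel_pair.Fubini_integrable)
    show "AE q in lborel. integrable lborel (\<lambda>x. case (q, x) of (q, x) \<Rightarrow> h x * k q * cis (- (q \<bullet> x)))"
      using h by (intro AE_I2 Bochner_Integration.integrable_bound[OF integrable_mult_left[OF h]]) (auto simp: norm_mult)
  qed (use h k in \<open>simp_all add: norm_mult\<close>)
  from lborel_pair.Fubini_integral[OF this]
  have "(LINT q|lborel. LINT x|lborel. h x * k q * cis (- (q \<bullet> x)))
    = (LINT x|lborel. LINT q|lborel. h x * k q * cis (- (q \<bullet> x)))" by simp
  then show ?thesis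
    by (simp add: fourier_def inner_commute mult_ac flip: integral_mult_right_zero)
qed

lemma integrable_gauss_mult_bounded:
  fixes h :: "'a::euclidean_space \<Rightarrow> complex"
  assumes "h \<in> borel_measurable borel" "\<And>x. cmod (h x) \<le> B" "e \<noteq> 0"
  shows "integrable lborel (\<lambda>x. of_real (gauss (e *\<^sub>R x)) * h x)"
proof (rule Bochner_Integration.integrable_bound)
  show "integrable lborel (\<lambda>x::'a. gauss (e *\<^sub>R x) * B)"
    using assms(3) by (intro integrable_mult_left integrable_gauss_scaleR)
  show "AE x in lborel. cmod (of_real (gauss (e *\<^sub>R x)) * h x) \<le> norm (gauss (e *\<^sub>R x) * B)"
    using assms(2) by (intro AE_I2) (auto simp: norm_mult abs_mult intro!: mult_left_mono order_trans[OF _ abs_ge_self])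
qed (use assms(1) in simp)

lemma fourier_inversion_gauss:
  fixes h :: "'a::euclidean_space \<Rightarrow> complex"
  assumes h: "integrable lborel h" and e: "e > 0"
  shows "fourier (\<lambda>q. of_real (gauss (e *\<^sub>R q)) * fourier h q) (- x)
    = of_real (sqrt (2 * pi) ^ DIM('a)) * (LINT w|lborel. of_real (gauss w) * h (x + e *\<^sub>R w))"
proof -
  let ?k = "\<lambda>q. of_real (gauss (e *\<^sub>R q)) * cis (q \<bullet> x)"
  have "integrable lborel ?k"
    using e by (intro integrable_gauss_mult_bounded[where B=1]) auto
  then have "(LINT q|lborel. fourier h q * ?k q) = (LINT x'|lborel. h x' * fourier ?k x')"
    by (rule fourier_multiplication_formula[OF h])
  moreover have "fourier ?k x' = fourier (\<lambda>q. of_real (gauss (e *\<^sub>R q))) (x' - x)" for x'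
    unfolding fourier_def mult.assoc cis_mult by (simp add: inner_diff_left inner_diff_right inner_commute)
  moreover have "fourier (\<lambda>q. of_real (gauss (e *\<^sub>R q)) * fourier h q) (- x) = (LINT q|lborel. fourier h q * ?k q)"
    unfolding fourier_def[of "\<lambda>q. of_real (gauss (e *\<^sub>R q)) * fourier h q"] by (simp add: inner_commute mult_ac)
  ultimately have "fourier (\<lambda>q. of_real (gauss (e *\<^sub>R q)) * fourier h q) (- x)
    = (LINT x'|lborel. h x' * fourier (\<lambda>q. of_real (gauss (e *\<^sub>R q))) (x' - x))"
    by simp
  also have "\<dots> = e ^ DIM('a) *\<^sub>R (LINT w|lborel. h (x + e *\<^sub>R w) * fourier (\<lambda>q. of_real (gauss (e *\<^sub>R q))) (e *\<^sub>R w))"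
    using e by (subst integral_lborel_affine[where c=e and t=x]) auto
  also have "\<dots> = e ^ DIM('a) *\<^sub>R
      (LINT w|lborel. of_real ((sqrt (2 * pi) / e) ^ DIM('a)) * (of_real (gauss w) * h (x + e *\<^sub>R w)))"
    using e by (simp add: fourier_gauss_scaleR mult_ac)
  also have "\<dots> = of_real (sqrt (2 * pi) ^ DIM('a)) * (LINT w|lborel. of_real (gauss w) * h (x + e *\<^sub>R w))"
    unfolding integral_mult_right_zero using e by (simp add: scaleR_conv_of_real power_divide)
  finally show ?thesis .
qed

lemma integrable_gauss_l2_inner_translate:
  fixes h k :: "'a::euclidean_space \<Rightarrow> complex"
  assumes h: "square_integrable h" and k: "square_integrable k"
  shows "integrable (lborel \<Otimes>\<^sub>M lborel) (\<lambda>(w, x). of_real (gauss w) * (h (e *\<^sub>R w + x) * cnj (k x)))"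
    (is "integrable _ ?H")
proof (rule lborel_pair.Fubini_integrable)
  have [measurable]: "h \<in> borel_measurable borel" "k \<in> borel_measurable borel"
    using h k by measurable
  show "?H \<in> borel_measurable (lborel \<Otimes>\<^sub>M lborel)"
    by measurable
  show "AE w in lborel. integrable lborel (\<lambda>x. ?H (w, x))"
    by (simp add: integrable_l2_inner square_integrable_translate h k)
  show "integrable lborel (\<lambda>w. LINT x|lborel. cmod (?H (w, x)))"
  proof (rule Bochner_Integration.integrable_bound)
    show "integrable lborel (\<lambda>w::'a. gauss w * (l2_norm h * l2_norm k))"
      by (intro integrable_mult_left integrable_gauss)
    have "(LINT x|lborel. cmod (h (e *\<^sub>R w + x)) * cmod (k x)) \<le> l2_norm h * l2_norm k" for w
      using Cauchy_Schwarz_l2[OF square_integrable_translate[OF h] k] by (simp add: l2_norm_translate norm_mult)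
    then show "AE w in lborel. norm (LINT x|lborel. cmod (?H (w, x))) \<le> norm (gauss w * (l2_norm h * l2_norm k))"
      by (intro AE_I2) (simp add: norm_mult abs_mult mult_left_mono)
  qed measurable
qed

lemma parseval_gauss:
  fixes h k :: "'a::euclidean_space \<Rightarrow> complex"
  assumes h: "integrable lborel h" "square_integrable h" and k: "integrable lborel k" "square_integrable k" and e: "e > 0"
  shows "(LINT q|lborel. of_real (gauss (e *\<^sub>R q)) * (fourier h q * cnj (fourier k q)))
    = of_real (sqrt (2 * pi) ^ DIM('a)) * (LINT w|lborel. of_real (gauss w) * l2_inner (\<lambda>x. h (e *\<^sub>R w + x)) k)"
proof -
  let ?c = "complex_of_real (sqrt (2 * pi) ^ DIM('a))" and ?m = "\<lambda>q. of_real (gauss (e *\<^sub>R q)) * fourier h q"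
    and ?H = "\<lambda>w x. of_real (gauss w) * (h (e *\<^sub>R w + x) * cnj (k x))"
  have k': "integrable lborel (\<lambda>x. cnj (k (- x)))"
    using integrable_lborel_affine[OF k(1), of "-1" 0] by simp
  have m: "integrable lborel ?m"
    using h(2) e by (intro integrable_gauss_mult_bounded[OF _ norm_fourier_le]) auto
  have "(LINT q|lborel. of_real (gauss (e *\<^sub>R q)) * (fourier h q * cnj (fourier k q)))
    = (LINT q|lborel. fourier (\<lambda>x. cnj (k (- x))) q * ?m q)"
    by (simp add: cnj_fourier mult_ac)
  also have "\<dots> = (LINT x|lborel. cnj (k (- x)) * fourier ?m x)"
    by (rule fourier_multiplication_formula[OF k' m])
  also have "\<dots> = (LINT x|lborel. cnj (k (- (0 - x))) * fourier ?m (0 - x))"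
    by (rule integral_lborel_reflect[symmetric])
  also have "\<dots> = (LINT x|lborel. cnj (k x) * fourier ?m (- x))"
    by simp
  also have "\<dots> = (LINT x|lborel. ?c * (LINT w|lborel. ?H w x))"
    unfolding fourier_inversion_gauss[OF h(1) e]
    by (simp add: add.commute mult_ac flip: integral_mult_right_zero)
  also have "\<dots> = ?c * (LINT x|lborel. LINT w|lborel. ?H w x)"
    by (rule integral_mult_right_zero)
  also have "(LINT x|lborel. LINT w|lborel. ?H w x) = (LINT w|lborel. LINT x|lborel. ?H w x)"
    by (rule lborel_pair.Fubini_integral[OF integrable_gauss_l2_inner_translate[OF h(2) k(2)]])
  also have "\<dots> = (LINT w|lborel. of_real (gauss w) * l2_inner (\<lambda>x. h (e *\<^sub>R w + x)) k)"
    by (simp add: l2_inner_def)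
  finally show ?thesis .
qed

lemma continuous_on_l2_inner_translate:
  assumes h: "square_integrable h" and k: "square_integrable k"
  shows "continuous_on UNIV (\<lambda>s. l2_inner (\<lambda>x. h (s + x)) k)"
proof -
  have "l2_inner (\<lambda>x. h (s + x)) k = cross_wigner h (\<lambda>x. k (- x)) ((1 / 2) *\<^sub>R s, 0)" for s
  proof -
    have "l2_inner (\<lambda>x. h (s + x)) k = (LINT t|lborel. h (s + (- (1 / 2) *\<^sub>R s + t)) * cnj (k (- (1 / 2) *\<^sub>R s + t)))"
      unfolding l2_inner_def by (rule integral_lborel_translate[symmetric])
    moreover have "s + (t - (1 / 2) *\<^sub>R s) = (1 / 2) *\<^sub>R s + t" for t
      using scaleR_left_distrib[of "1/2" "1/2" s] by (simp add: algebra_simps)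
    ultimately show ?thesis
      by (simp add: cross_wigner_def fourier_def)
  qed
  moreover have "square_integrable (\<lambda>x. k (- x))"
    using square_integrable_reflect[OF k, of 0] by simp
  ultimately show ?thesis
    by (simp add: continuous_on_compose2[OF continuous_on_cross_wigner[OF h]] continuous_intros)
qed

lemma parseval_gauss_tendsto:
  fixes h k :: "'a::euclidean_space \<Rightarrow> complex"
  assumes h: "integrable lborel h" "square_integrable h" and k: "integrable lborel k" "square_integrable k"
    and e: "\<And>n. e n > 0" "e \<longlonglongrightarrow> 0"
  shows "(\<lambda>n. LINT q|lborel. of_real (gauss (e n *\<^sub>R q)) * (fourier h q * cnj (fourier k q)))
    \<longlonglongrightarrow> of_real ((2 * pi) ^ DIM('a)) * l2_inner h k"
proof -
  let ?R = "\<lambda>s. l2_inner (\<lambda>x. h (s + x)) k"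
  have R: "continuous_on UNIV ?R" by (rule continuous_on_l2_inner_translate[OF h(2) k(2)])
  have R_le: "cmod (?R s) \<le> l2_norm h * l2_norm k" for s
    using norm_l2_inner_le[OF square_integrable_translate[OF h(2)] k(2)] by (simp add: l2_norm_translate)
  have "(\<lambda>n. LINT w|lborel. of_real (gauss w) * ?R (e n *\<^sub>R w)) \<longlonglongrightarrow> (LINT w|lborel. of_real (gauss (w::'a)) * ?R 0)"
  proof (rule integral_dominated_convergence)
    show "integrable lborel (\<lambda>w::'a. gauss w * (l2_norm h * l2_norm k))"
      by (intro integrable_mult_left integrable_gauss)
    show "AE w in lborel. cmod (of_real (gauss w) * ?R (e n *\<^sub>R w)) \<le> gauss w * (l2_norm h * l2_norm k)" for n
      using R_le by (intro AE_I2) (simp add: norm_mult mult_left_mono)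
    have "(\<lambda>n. ?R (e n *\<^sub>R w)) \<longlonglongrightarrow> ?R 0" for w :: 'a
      using tendsto_scaleR[OF e(2) tendsto_const[of w]]
      by (intro continuous_on_tendsto_compose[OF R]) auto
    then show "AE w in lborel. (\<lambda>n. of_real (gauss w) * ?R (e n *\<^sub>R w)) \<longlonglongrightarrow> of_real (gauss w) * ?R 0"
      by (intro AE_I2 tendsto_intros)
    have "(\<lambda>w. of_real (gauss w) * ?R (e n *\<^sub>R w)) \<in> borel_measurable borel" for n
      by (intro borel_measurable_continuous_onI continuous_intros continuous_on_compose2[OF R]) auto
    then show "(\<lambda>w. of_real (gauss w) * ?R (e n *\<^sub>R w)) \<in> borel_measurable lborel" for n by simp
  qed simp
  then have "(\<lambda>n. of_real (sqrt (2 * pi) ^ DIM('a)) * (LINT w|lborel. of_real (gauss w) * ?R (e n *\<^sub>R w)))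
    \<longlonglongrightarrow> of_real (sqrt (2 * pi) ^ DIM('a)) * (of_real (sqrt (2 * pi) ^ DIM('a)) * l2_inner h k)"
    by (intro tendsto_intros) (simp add: integral_gauss)
  moreover have "of_real (sqrt (2 * pi) ^ DIM('a)) * (of_real (sqrt (2 * pi) ^ DIM('a)) * z)
    = of_real ((2 * pi) ^ DIM('a)) * z" for z :: complex
  proof -
    have "sqrt (2 * pi) ^ DIM('a) * sqrt (2 * pi) ^ DIM('a) = (2 * pi) ^ DIM('a)"
      unfolding power_mult_distrib[symmetric] by simp
    then show ?thesis
      by (simp only: mult.assoc[symmetric] of_real_mult[symmetric])
  qed
  ultimately show ?thesis
    by (simp only: parseval_gauss[OF h k e(1)] add_0)
qed

theorem square_integrable_fourier:
  fixes h :: "'a::euclidean_space \<Rightarrow> complex"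
  assumes h: "integrable lborel h" "square_integrable h"
  shows "square_integrable (fourier h)"
proof -
  define e where "e n = inverse (real (Suc n))" for n
  have e_pos: "e n > 0" for n by (simp add: e_def)
  have e_lim: "e \<longlonglongrightarrow> 0" unfolding e_def[abs_def] by (rule LIMSEQ_inverse_real_of_nat)
  have [measurable]: "fourier h \<in> borel_measurable borel" using h(2) by measurable
  let ?u = "\<lambda>n q. gauss (e n *\<^sub>R q) * (cmod (fourier h q))\<^sup>2"
  have complex_u: "complex_of_real (?u n q) = of_real (gauss (e n *\<^sub>R q)) * (fourier h q * cnj (fourier h q))" for n q
    by (simp only: of_real_mult complex_norm_square)
  have "integrable lborel (\<lambda>q. (cmod (fourier h q))\<^sup>2)"
  proof (rule integrable_monotone_convergence)
    fix n
    have "integrable lborel (\<lambda>q. complex_of_real (gauss (e n *\<^sub>R q)) * (fourier h q * cnj (fourier h q)))"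
      using e_pos[of n] norm_fourier_le[of h]
      by (intro integrable_gauss_mult_bounded[where B="(LINT x|lborel. cmod (h x)) * (LINT x|lborel. cmod (h x))"])
         (auto simp: norm_mult intro!: mult_mono)
    then show "integrable lborel (?u n)"
      by (simp only: complex_u[symmetric] complex_of_real_integrable_eq)
    have "(\<lambda>n. complex_of_real (LINT q|lborel. ?u n q)) \<longlonglongrightarrow> of_real ((2 * pi) ^ DIM('a)) * of_real ((l2_norm h)\<^sup>2)"
      using parseval_gauss_tendsto[OF h h e_pos e_lim]
      unfolding complex_u[symmetric] integral_complex_of_real l2_inner_self .
    then show "(\<lambda>n. LINT q|lborel. ?u n q) \<longlonglongrightarrow> (2 * pi) ^ DIM('a) * (l2_norm h)\<^sup>2"
      unfolding of_real_mult[symmetric] tendsto_of_real_iff .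
    have "e n \<le> e m" if "m \<le> n" for m n
      using that by (simp add: e_def)
    then have "gauss (e m *\<^sub>R q) \<le> gauss (e n *\<^sub>R q)" if "m \<le> n" for m n and q :: 'a
      using that e_pos by (auto simp: gauss_def less_imp_le intro!: power_mono mult_right_mono)
    then show "AE q in lborel. mono (\<lambda>n. ?u n q)"
      by (intro AE_I2 monoI mult_right_mono) auto
    have "(\<lambda>n. ?u n q) \<longlonglongrightarrow> 1 * (cmod (fourier h q))\<^sup>2" for q
      by (intro tendsto_mult tendsto_const gauss_scaleR_tendsto_1 e_lim)
    then show "AE q in lborel. (\<lambda>n. ?u n q) \<longlonglongrightarrow> (cmod (fourier h q))\<^sup>2" by simp
  qed simp
  then show ?thesis by (simp add: square_integrable_def)
qed

theorem parseval:
  fixes h k :: "'a::euclidean_space \<Rightarrow> complex"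
  assumes h: "integrable lborel h" "square_integrable h" and k: "integrable lborel k" "square_integrable k"
  shows "l2_inner (fourier h) (fourier k) = of_real ((2 * pi) ^ DIM('a)) * l2_inner h k"
proof -
  let ?e = "\<lambda>n. inverse (real (Suc n))"
  have [measurable]: "fourier h \<in> borel_measurable borel" "fourier k \<in> borel_measurable borel"
    using h(2) k(2) by measurable
  have "(\<lambda>n. LINT q|lborel. of_real (gauss (?e n *\<^sub>R q)) * (fourier h q * cnj (fourier k q)))
    \<longlonglongrightarrow> l2_inner (fourier h) (fourier k)"
    unfolding l2_inner_def
  proof (rule integral_dominated_convergence)
    show "integrable lborel (\<lambda>q. cmod (fourier h q * cnj (fourier k q)))"
      by (intro integrable_norm integrable_l2_inner square_integrable_fourier h k)
    show "AE q in lborel. cmod (of_real (gauss (?e n *\<^sub>R q)) * (fourier h q * cnj (fourier k q)))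
        \<le> cmod (fourier h q * cnj (fourier k q))" for n
      unfolding norm_mult[of "of_real _"] by (intro AE_I2 mult_left_le_one_le) auto
    have "(\<lambda>n. of_real (gauss (?e n *\<^sub>R q)) * (fourier h q * cnj (fourier k q)))
        \<longlonglongrightarrow> of_real 1 * (fourier h q * cnj (fourier k q))" for q
      by (intro tendsto_mult tendsto_const tendsto_of_real gauss_scaleR_tendsto_1 LIMSEQ_inverse_real_of_nat)
    then show "AE q in lborel. (\<lambda>n. of_real (gauss (?e n *\<^sub>R q)) * (fourier h q * cnj (fourier k q)))
        \<longlonglongrightarrow> fourier h q * cnj (fourier k q)" by simp
  qed measurable
  then show ?thesis
    using parseval_gauss_tendsto[OF h k _ LIMSEQ_inverse_real_of_nat] by (intro LIMSEQ_unique) auto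
qed

corollary plancherel:
  fixes h :: "'a::euclidean_space \<Rightarrow> complex"
  assumes "integrable lborel h" "square_integrable h"
  shows "(l2_norm (fourier h))\<^sup>2 = (2 * pi) ^ DIM('a) * (l2_norm h)\<^sup>2"
  using parseval[OF assms assms] unfolding l2_inner_self of_real_mult[symmetric] of_real_eq_iff .

section \<open>Moyal's identity\<close>

lemma
  fixes a b :: "'a::euclidean_space \<Rightarrow> 'b::{real_normed_field, banach, second_countable_topology}"
  assumes a: "integrable lborel a" and b: "integrable lborel b"
  shows AE_integrable_midpoint_product: "AE y in lborel. integrable lborel (\<lambda>t. a (y + t) * b (y - t))"
    and integrable_midpoint_product: "integrable lborel (\<lambda>y. LINT t|lborel. a (y + t) * b (y - t))"
    and integral_midpoint_product: "(LINT y|lborel. LINT t|lborel. a (y + t) * b (y - t))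
      = (1 / 2) ^ DIM('a) *\<^sub>R ((LINT x|lborel. a x) * (LINT x|lborel. b x))"
proof -
  have [measurable]: "a \<in> borel_measurable borel" "b \<in> borel_measurable borel"
    using borel_measurable_integrable[OF a] borel_measurable_integrable[OF b] by simp_all
  have rescale: "integrable lborel (\<lambda>y. h (2 *\<^sub>R y - u))"
    "(LINT y|lborel. h (2 *\<^sub>R y - u)) = (1 / 2) ^ DIM('a) *\<^sub>R (LINT x|lborel. h x)"
    if "integrable lborel h" for h :: "'a \<Rightarrow> 'd::{banach, second_countable_topology}" and u
    using integrable_lborel_affine[OF that, of 2 "- u"] integral_lborel_affine[of 2 h "- u"]
    by (simp_all add: power_divide)
  let ?K = "\<lambda>u y. a u * b (2 *\<^sub>R y - u)"
  have K: "integrable (lborel \<Otimes>\<^sub>M lborel) (case_prod ?K)"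
    by (rule lborel_pair.Fubini_integrable)
       (use a b in \<open>simp_all add: norm_mult rescale rescale[OF integrable_norm[OF b]]\<close>)
  have K_midpoint: "?K (y + t) y = a (y + t) * b (y - t)" for y t
    by (simp add: scaleR_2)
  have midpoint: "(LINT t|lborel. a (y + t) * b (y - t)) = (LINT u|lborel. ?K u y)" for y
    using integral_lborel_translate[of "\<lambda>u. ?K u y" y] by (simp only: K_midpoint)
  show "AE y in lborel. integrable lborel (\<lambda>t. a (y + t) * b (y - t))"
    using lborel_pair.AE_integrable_snd[OF K]
  proof eventually_elim
    case (elim y)
    from integrable_lborel_affine[OF this, of 1 y] show ?case
      by (simp only: scaleR_one K_midpoint)
  qed
  show "integrable lborel (\<lambda>y. LINT t|lborel. a (y + t) * b (y - t))"
    unfolding midpoint by (rule lborel_pair.integrable_snd[OF K])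
  have "(LINT y|lborel. LINT t|lborel. a (y + t) * b (y - t)) = (LINT u|lborel. LINT y|lborel. ?K u y)"
    unfolding midpoint by (rule lborel_pair.Fubini_integral[OF K])
  then show "(LINT y|lborel. LINT t|lborel. a (y + t) * b (y - t))
      = (1 / 2) ^ DIM('a) *\<^sub>R ((LINT x|lborel. a x) * (LINT x|lborel. b x))"
    by (simp add: rescale(2)[OF b])
qed

lemma integrable_wigner_integrand:
  "square_integrable f \<Longrightarrow> square_integrable g \<Longrightarrow> integrable lborel (\<lambda>t. f (y + t) * cnj (g (y - t)))"
  by (intro integrable_l2_inner square_integrable_translate square_integrable_reflect)

lemma AE_square_integrable_wigner_integrand:
  assumes f: "square_integrable f" and g: "square_integrable g"
  shows "AE y in lborel. square_integrable (\<lambda>t. f (y + t) * cnj (g (y - t)))"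
  using AE_integrable_midpoint_product[OF integrable_cmod_square[OF f] integrable_cmod_square[OF g]]
proof eventually_elim
  case (elim y)
  then show ?case
    using borel_measurable_integrable[OF integrable_wigner_integrand[OF f g, of y]]
    by (simp add: square_integrable_def norm_mult power_mult_distrib)
qed

theorem square_integrable_cross_wigner:
  fixes f g :: "'a::euclidean_space \<Rightarrow> complex"
  assumes f: "square_integrable f" and g: "square_integrable g"
  shows "square_integrable (cross_wigner f g)"
proof -
  let ?slice = "\<lambda>y t. f (y + t) * cnj (g (y - t))" and ?E = "\<lambda>z. (cmod (cross_wigner f g z))\<^sup>2"
  have [measurable]: "cross_wigner f g \<in> borel_measurable (lborel \<Otimes>\<^sub>M lborel)"
    using borel_measurable_cross_wigner[OF f g] by (simp add: lborel_prod)
  have slice_energy: "integrable lborel (\<lambda>q. ?E (y, q))"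
    "(2 * pi) ^ DIM('a) * (LINT t|lborel. (cmod (f (y + t)))\<^sup>2 * (cmod (g (y - t)))\<^sup>2) = (LINT q|lborel. ?E (y, q))"
    if "square_integrable (?slice y)" for y
    using integrable_cmod_square[OF square_integrable_fourier[OF integrable_wigner_integrand[OF f g] that]]
      plancherel[OF integrable_wigner_integrand[OF f g] that]
    by (simp_all add: cross_wigner_def l2_norm_square norm_mult power_mult_distrib)
  note AE_slice = AE_square_integrable_wigner_integrand[OF f g]
  have "integrable (lborel \<Otimes>\<^sub>M lborel) ?E"
  proof (rule lborel_pair.Fubini_integrable)
    show "AE y in lborel. integrable lborel (\<lambda>q. ?E (y, q))"
      using AE_slice by eventually_elim (rule slice_energy)
    have "integrable lborel (\<lambda>y. LINT q|lborel. ?E (y, q))"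
    proof (rule integrable_cong_AE_imp)
      show "integrable lborel (\<lambda>y. (2 * pi) ^ DIM('a) * (LINT t|lborel. (cmod (f (y + t)))\<^sup>2 * (cmod (g (y - t)))\<^sup>2))"
        by (intro integrable_mult_right integrable_midpoint_product integrable_cmod_square f g)
      show "AE y in lborel. (2 * pi) ^ DIM('a) * (LINT t|lborel. (cmod (f (y + t)))\<^sup>2 * (cmod (g (y - t)))\<^sup>2)
          = (LINT q|lborel. ?E (y, q))"
        using AE_slice by eventually_elim (rule slice_energy)
    qed measurable
    then show "integrable lborel (\<lambda>y. LINT q|lborel. norm (?E (y, q)))" by simp
  qed measurable
  then show ?thesis
    using borel_measurable_cross_wigner[OF f g] by (simp add: square_integrable_def lborel_prod)
qed

theorem moyal_identity:
  fixes f1 f2 g1 g2 :: "'a::euclidean_space \<Rightarrow> complex"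
  assumes f: "square_integrable f1" "square_integrable f2" and g: "square_integrable g1" "square_integrable g2"
  shows "l2_inner (cross_wigner f1 g1) (cross_wigner f2 g2)
    = of_real (pi ^ DIM('a)) * (l2_inner f1 f2 * cnj (l2_inner g1 g2))"
proof -
  let ?H = "\<lambda>z. cross_wigner f1 g1 z * cnj (cross_wigner f2 g2 z)"
  let ?a = "\<lambda>x. f1 x * cnj (f2 x)" and ?b = "\<lambda>x. cnj (g1 x) * g2 x"
  have H: "integrable (lborel \<Otimes>\<^sub>M lborel) ?H"
    unfolding lborel_prod by (intro integrable_l2_inner square_integrable_cross_wigner f g)
  have a: "integrable lborel ?a" and b: "integrable lborel ?b"
    using integrable_l2_inner[OF f] integrable_l2_inner[OF g(2,1)] by (simp_all add: mult.commute)
  have b_eq: "(LINT x|lborel. ?b x) = cnj (l2_inner g1 g2)"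
    using cnj_l2_inner[of g1 g2] by (simp add: l2_inner_def mult.commute)
  have "AE y in lborel. (LINT q|lborel. ?H (y, q)) = of_real ((2 * pi) ^ DIM('a)) * (LINT t|lborel. ?a (y + t) * ?b (y - t))"
    using AE_square_integrable_wigner_integrand[OF f(1) g(1)] AE_square_integrable_wigner_integrand[OF f(2) g(2)]
  proof eventually_elim
    case (elim y)
    from parseval[OF integrable_wigner_integrand[OF f(1) g(1)] elim(1) integrable_wigner_integrand[OF f(2) g(2)] elim(2)]
    show ?case by (simp add: cross_wigner_def l2_inner_def mult_ac)
  qed
  then have "(LINT y|lborel. LINT q|lborel. ?H (y, q))
    = (LINT y|lborel. of_real ((2 * pi) ^ DIM('a)) * (LINT t|lborel. ?a (y + t) * ?b (y - t)))"
    using borel_measurable_integrable[OF lborel_pair.integrable_fst'[OF H]]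
      borel_measurable_integrable[OF integrable_midpoint_product[OF a b]]
    by (intro integral_cong_AE) simp_all
  also have "\<dots> = of_real ((2 * pi) ^ DIM('a)) * ((1 / 2) ^ DIM('a) *\<^sub>R (l2_inner f1 f2 * cnj (l2_inner g1 g2)))"
    unfolding integral_mult_right_zero integral_midpoint_product[OF a b] b_eq by (simp add: l2_inner_def)
  also have "\<dots> = of_real (pi ^ DIM('a)) * (l2_inner f1 f2 * cnj (l2_inner g1 g2))"
    by (simp add: scaleR_conv_of_real power_mult_distrib power_divide)
  finally show ?thesis
    using lborel_pair.integral_fst'[OF H] by (simp add: l2_inner_def lborel_prod)
qed

section \<open>The diagonal Wigner function\<close>

definition auto_wigner :: "('a::euclidean_space \<Rightarrow> complex) \<Rightarrow> 'a \<times> 'a \<Rightarrow> real" where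
  "auto_wigner f z = Re (cross_wigner f f z)"

lemma cross_wigner_self: "cross_wigner f f z = of_real (auto_wigner f z)"
  using cnj_cross_wigner[of f f z] by (simp add: auto_wigner_def complex_eq_iff)

lemma continuous_on_auto_wigner:
  "square_integrable f \<Longrightarrow> continuous_on UNIV (auto_wigner f)"
  unfolding auto_wigner_def[abs_def] by (intro continuous_intros continuous_on_cross_wigner)

lemma open_auto_wigner_neg: "square_integrable f \<Longrightarrow> open {z. auto_wigner f z < 0}"
  by (intro open_Collect_less continuous_on_auto_wigner continuous_on_const)

lemma
  fixes f g :: "'a::euclidean_space \<Rightarrow> complex"
  assumes f: "square_integrable f" and g: "square_integrable g"
  shows integrable_auto_wigner_mult: "integrable lborel (\<lambda>z. auto_wigner f z * auto_wigner g z)"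
    and integral_auto_wigner_mult:
      "(LINT z|lborel. auto_wigner f z * auto_wigner g z) = pi ^ DIM('a) * (cmod (l2_inner f g))\<^sup>2"
proof -
  have integrand: "cross_wigner f f z * cnj (cross_wigner g g z) = of_real (auto_wigner f z * auto_wigner g z)" for z
    by (simp add: cross_wigner_self)
  show "integrable lborel (\<lambda>z. auto_wigner f z * auto_wigner g z)"
    using integrable_l2_inner[OF square_integrable_cross_wigner[OF f f] square_integrable_cross_wigner[OF g g]]
    unfolding integrand complex_of_real_integrable_eq .
  have "complex_of_real (LINT z|lborel. auto_wigner f z * auto_wigner g z)
    = of_real (pi ^ DIM('a) * (cmod (l2_inner f g))\<^sup>2)"
    using moyal_identity[OF f g f g]
    unfolding l2_inner_def[of "cross_wigner f f"] integrand integral_complex_of_real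
    by (simp only: of_real_mult complex_norm_square)
  then show "(LINT z|lborel. auto_wigner f z * auto_wigner g z) = pi ^ DIM('a) * (cmod (l2_inner f g))\<^sup>2"
    by (simp only: of_real_eq_iff)
qed

lemma cmod_l2_inner_parity: "cmod (l2_inner f (parity a f)) = \<bar>auto_wigner f a\<bar>"
proof -
  have "cmod (l2_inner f (parity a f)) = cmod (cross_wigner f f a)"
    unfolding cross_wigner_eq_l2_inner cnj_l2_inner[of f, symmetric] by simp
  then show ?thesis by (simp add: cross_wigner_self)
qed

lemma auto_wigner_parity: "auto_wigner (parity a f) v = auto_wigner f (2 *\<^sub>R a - v)"
  by (simp add: auto_wigner_def cross_wigner_parity symplectic_form_def inner_commute scaleR_2)

lemma cmod_cross_wigner_parity: "cmod (cross_wigner (parity a f) (parity b f) v) = \<bar>auto_wigner f (a + b - v)\<bar>"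
  by (simp add: cross_wigner_parity norm_mult cross_wigner_self)

lemma
  fixes f :: "'a::euclidean_space \<Rightarrow> complex"
  assumes f: "square_integrable f"
  shows integrable_auto_wigner_reflect: "integrable lborel (\<lambda>v. auto_wigner f v * auto_wigner f (2 *\<^sub>R z - v))"
    and integral_auto_wigner_reflect:
      "(LINT v|lborel. auto_wigner f v * auto_wigner f (2 *\<^sub>R z - v)) = pi ^ DIM('a) * (auto_wigner f z)\<^sup>2"
  using integrable_auto_wigner_mult[OF f square_integrable_parity[OF f]]
    integral_auto_wigner_mult[OF f square_integrable_parity[OF f]]
  by (simp_all add: auto_wigner_parity cmod_l2_inner_parity)

lemma auto_wigner_mult_le:
  fixes f :: "'a::euclidean_space \<Rightarrow> complex"
  assumes f: "square_integrable f"
  shows "pi ^ DIM('a) * \<bar>auto_wigner f a * auto_wigner f b\<bar>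
    \<le> (LINT v|lborel. \<bar>auto_wigner f v * auto_wigner f (a + b - v)\<bar>)"
proof -
  have "pi ^ DIM('a) * \<bar>auto_wigner f a * auto_wigner f b\<bar>
    = cmod (l2_inner (cross_wigner f f) (cross_wigner (parity a f) (parity b f)))"
    by (simp add: moyal_identity f square_integrable_parity norm_mult norm_power cmod_l2_inner_parity abs_mult)
  also have "\<dots> \<le> (LINT v|lborel. cmod (cross_wigner f f v * cnj (cross_wigner (parity a f) (parity b f) v)))"
    unfolding l2_inner_def by (rule integral_norm_bound)
  also have "\<dots> = (LINT v|lborel. \<bar>auto_wigner f v * auto_wigner f (a + b - v)\<bar>)"
    by (simp add: norm_mult cross_wigner_self[of f] cmod_cross_wigner_parity abs_mult)
  finally show ?thesis .
qed

section \<open>Positive values of the Wigner function\<close>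

lemma square_integrable_gauss: "square_integrable (\<lambda>x. complex_of_real (gauss x))"
  by (rule square_integrable_bound[OF integrable_gauss])
     (auto simp: power2_eq_square intro!: mult_left_le)

lemma auto_wigner_gauss:
  fixes y q :: "'a::euclidean_space"
  shows "auto_wigner (\<lambda>x. of_real (gauss x)) (y, q)
    = gauss (sqrt 2 *\<^sub>R y) * (sqrt pi ^ DIM('a) * gauss ((1 / sqrt 2) *\<^sub>R q))"
proof -
  have parallelogram: "gauss (y + t) * gauss (y - t) = gauss (sqrt 2 *\<^sub>R y) * gauss (sqrt 2 *\<^sub>R t)" for t :: 'a
  proof -
    have "(norm (y + t))\<^sup>2 + (norm (y - t))\<^sup>2 = 2 * (norm y)\<^sup>2 + 2 * (norm t)\<^sup>2"
      by (simp add: power2_norm_eq_inner inner_simps inner_commute)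
    then show ?thesis
      unfolding gauss_def exp_add[symmetric] by (simp add: power_mult_distrib)
  qed
  have "cross_wigner (\<lambda>x. of_real (gauss x)) (\<lambda>x. of_real (gauss x)) (y, q)
    = of_real (gauss (sqrt 2 *\<^sub>R y)) * fourier (\<lambda>t. of_real (gauss (sqrt 2 *\<^sub>R t))) q"
    unfolding cross_wigner_def prod.case complex_cnj_complex_of_real of_real_mult[symmetric] parallelogram
    by (simp add: fourier_def mult.assoc)
  also have "\<dots> = of_real (gauss (sqrt 2 *\<^sub>R y) * (sqrt pi ^ DIM('a) * gauss ((1 / sqrt 2) *\<^sub>R q)))"
    by (simp add: fourier_gauss_scaleR real_sqrt_mult)
  finally show ?thesis
    by (simp only: auto_wigner_def Re_complex_of_real)
qed

lemma continuous_eq_0_if_AE_eq_0: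
  fixes h :: "'a::euclidean_space \<Rightarrow> real"
  assumes "continuous_on UNIV h" "AE x in lborel. h x = 0"
  shows "h x = 0"
proof (rule ccontr)
  assume "h x \<noteq> 0"
  moreover have nonzero: "open {x. h x \<noteq> 0}"
    by (intro open_Collect_neq assms continuous_on_const)
  moreover have "negligible {x. h x \<noteq> 0}"
    using assms(2) nonzero by (auto simp: negligible_iff_null_sets null_sets_completionI AE_iff_null)
  ultimately show False using open_not_negligible by blast
qed

lemma exists_auto_wigner_pos:
  fixes f :: "'a::euclidean_space \<Rightarrow> complex"
  assumes f: "square_integrable f" and nonzero: "auto_wigner f z \<noteq> 0"
  shows "\<exists>w. auto_wigner f w > 0"
proof (rule ccontr)
  assume "\<not> ?thesis"
  then have neg: "auto_wigner f w \<le> 0" for w by (meson not_le)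
  let ?G = "auto_wigner (\<lambda>x::'a. complex_of_real (gauss x))"
  let ?h = "\<lambda>w. - (auto_wigner f w * ?G w)"
  have G_pos: "?G w > 0" for w
    by (cases w) (simp add: auto_wigner_gauss)
  have h: "integrable lborel ?h"
    by (intro integrable_minus integrable_auto_wigner_mult f square_integrable_gauss)
  have h_nonneg: "0 \<le> ?h w" for w
    using mult_nonpos_nonneg[OF neg less_imp_le[OF G_pos]] by simp
  have "(LINT w|lborel. ?h w) = 0"
  proof (rule antisym)
    show "(LINT w|lborel. ?h w) \<le> 0"
      by (simp add: integral_auto_wigner_mult f square_integrable_gauss)
    show "0 \<le> (LINT w|lborel. ?h w)"
      by (intro Bochner_Integration.integral_nonneg h_nonneg)
  qed
  then have "AE w in lborel. ?h w = 0"
    using integral_nonneg_eq_0_iff_AE[OF h] h_nonneg by simp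
  then have "?h z = 0"
    by (rule continuous_eq_0_if_AE_eq_0[rotated])
       (intro continuous_intros continuous_on_auto_wigner f square_integrable_gauss)
  with nonzero G_pos[of z] show False by simp
qed

section \<open>The measure of the negative set\<close>

lemma emeasure_lborel_reflect:
  fixes S :: "'a::euclidean_space set"
  assumes [measurable]: "S \<in> sets borel"
  shows "emeasure lborel {v. a - v \<in> S} = emeasure lborel S"
proof -
  have [measurable]: "{v. a - v \<in> S} \<in> sets borel"
    by measurable
  have "emeasure lborel S = (\<integral>\<^sup>+v. indicator S (a + (-1) *\<^sub>R v) \<partial>lborel)"
    using nn_integral_lborel_affine[of "indicator S" "-1" a] by simp
  also have "\<dots> = (\<integral>\<^sup>+v. indicator {v. a - v \<in> S} v \<partial>lborel)"
    by (intro nn_integral_cong) (auto simp: indicator_def)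
  also have "\<dots> = emeasure lborel {v. a - v \<in> S}"
    by simp
  finally show ?thesis by simp
qed

lemma emeasure_negative_ge_if_sup_le_integral:
  fixes G :: "'a \<Rightarrow> real"
  assumes G: "integrable M G" and integral_le: "(LINT x|M. G x) \<le> 0" and c: "c > 0"
    and sup: "\<And>x. c * \<bar>G x\<bar> \<le> (LINT x|M. \<bar>G x\<bar>)" and nonzero: "G w \<noteq> 0"
  shows "ennreal (c / 2) \<le> emeasure M {x \<in> space M. G x < 0}" (is "_ \<le> emeasure M ?N")
proof (cases "emeasure M ?N = \<infinity>")
  case False
  define I where "I = (LINT x|M. \<bar>G x\<bar>)"
  have [measurable]: "G \<in> borel_measurable M" using G by simp
  have "0 < c * \<bar>G w\<bar>" using c nonzero by simp
  with sup[of w] have I: "I > 0" by (simp add: I_def)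
  have "I \<le> (LINT x|M. \<bar>G x\<bar> - G x)"
    using G integral_le by (simp add: I_def)
  also have "\<dots> \<le> (LINT x|M. 2 * I / c * indicator ?N x)"
  proof (rule integral_mono)
    show "integrable M (\<lambda>x. 2 * I / c * indicator ?N x)"
      using False by (intro integrable_mult_right integrable_real_indicator) (auto simp: less_top)
    fix x assume "x \<in> space M"
    moreover have "\<bar>G x\<bar> \<le> I / c"
      using sup[of x] c by (simp add: I_def field_simps)
    ultimately show "\<bar>G x\<bar> - G x \<le> 2 * I / c * indicator ?N x"
      by (cases "G x < 0") auto
  qed (use G in simp)
  also have "\<dots> = 2 * I / c * measure M ?N"
    by simp
  finally have "c / 2 \<le> measure M ?N"
    using I c by (simp add: field_simps)
  then show ?thesis
    using False by (simp add: emeasure_eq_ennreal_measure ennreal_leI)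
qed simp

lemma zero_at_midpoint_of_nonzeros_real:
  fixes \<phi> :: "real \<Rightarrow> real"
  assumes cont: "continuous_on UNIV \<phi>" and "\<phi> 0 < 0" "\<phi> 1 > 0"
  obtains x y where "\<phi> x \<noteq> 0" "\<phi> y \<noteq> 0" "\<phi> ((x + y) / 2) = 0"
proof -
  let ?Z = "{s \<in> {0..1}. \<phi> s = 0}"
  have "\<exists>s\<ge>0. s \<le> 1 \<and> \<phi> s = 0"
    using assms by (intro IVT') (auto intro: continuous_on_subset)
  then have "?Z \<noteq> {}" by auto
  moreover have "closed {s. \<phi> s = 0}"
    by (intro closed_Collect_eq cont continuous_on_const)
  then have "compact ({0..1} \<inter> {s. \<phi> s = 0})"
    by (intro compact_Int_closed compact_Icc)
  then have "compact ?Z" by (simp add: Int_def)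
  ultimately obtain t where t: "t \<in> ?Z" and t_least: "\<And>s. s \<in> ?Z \<Longrightarrow> t \<le> s"
    using compact_attains_inf[of ?Z] by blast
  have "t > 0" using t assms(2) by (cases "t = 0") auto
  define V where "V = {s. t \<le> s \<and> \<phi> s \<noteq> 0}"
  have V: "V \<noteq> {}" "bdd_below V" using t assms(3) by (auto simp: V_def)
  then have "t \<le> Inf V" by (intro cInf_greatest) (auto simp: V_def)
  with \<open>t > 0\<close> have "Inf V < 2 * Inf V" by simp
  then obtain y where "y \<in> V" and y_less: "y < 2 * Inf V"
    using cInf_less_iff[OF V] by blast
  then have y: "t \<le> y" "\<phi> y \<noteq> 0" by (simp_all add: V_def)
  \<comment> \<open>Either \<open>x\<close> is the reflection of \<open>y\<close> in the least zero \<open>t\<close>, or \<open>x = 0\<close> and \<open>y / 2\<close> lies between \<open>t\<close> and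
    \<open>Inf V\<close>, where \<open>\<phi>\<close> vanishes.\<close>
  define x where "x = max 0 (2 * t - y)"
  have "y > t" using t y by (cases "y = t") auto
  then have "x \<in> {0..<t}" using \<open>t > 0\<close> by (auto simp: x_def)
  then have "\<phi> x \<noteq> 0" using t t_least[of x] by auto
  moreover have "\<phi> ((x + y) / 2) = 0"
  proof (cases "y \<le> 2 * t")
    case True
    with t show ?thesis by (simp add: x_def)
  next
    case False
    with y_less have "(x + y) / 2 < Inf V" "t \<le> (x + y) / 2" by (auto simp: x_def)
    moreover from this have "(x + y) / 2 \<notin> V" using cInf_lower[OF _ V(2)] not_le by blast
    ultimately show ?thesis by (simp add: V_def)
  qed
  ultimately show thesis using y(2) by (intro that)
qed

lemma zero_at_midpoint_of_nonzeros:
  fixes h :: "'a::real_normed_vector \<Rightarrow> real"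
  assumes cont: "continuous_on UNIV h" and "h a < 0" "h b > 0"
  obtains x y where "h x \<noteq> 0" "h y \<noteq> 0" "h (midpoint x y) = 0"
proof -
  let ?p = "\<lambda>t. a + t *\<^sub>R (b - a)"
  have "continuous_on UNIV (\<lambda>t. h (?p t))"
    by (intro continuous_on_compose2[OF cont] continuous_intros) auto
  then obtain s t where "h (?p s) \<noteq> 0" "h (?p t) \<noteq> 0" "h (?p ((s + t) / 2)) = 0"
    using assms by (elim zero_at_midpoint_of_nonzeros_real) auto
  moreover have "?p s + ?p t = 2 *\<^sub>R ?p ((s + t) / 2)"
    by (simp add: scaleR_add_right scaleR_add_left add_divide_distrib scaleR_2)
  then have "midpoint (?p s) (?p t) = ?p ((s + t) / 2)"
    by (simp add: midpoint_def)
  ultimately show thesis by (intro that[of "?p s" "?p t"]) simp_all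
qed

theorem emeasure_auto_wigner_neg_ge:
  fixes f :: "'a::euclidean_space \<Rightarrow> complex"
  assumes f: "square_integrable f" and neg: "auto_wigner f z < 0"
  shows "ennreal (pi ^ DIM('a) / 4) \<le> emeasure lborel {z. auto_wigner f z < 0}" (is "_ \<le> emeasure lborel ?N")
proof -
  obtain z' where "auto_wigner f z' > 0"
    using exists_auto_wigner_pos[OF f, of z] neg by auto
  then obtain a b where ab: "auto_wigner f a \<noteq> 0" "auto_wigner f b \<noteq> 0" "auto_wigner f (midpoint a b) = 0"
    using zero_at_midpoint_of_nonzeros[OF continuous_on_auto_wigner[OF f] neg] by blast
  define G where "G v = auto_wigner f v * auto_wigner f (a + b - v)" for v
  have ab_eq: "a + b = 2 *\<^sub>R midpoint a b" by (simp add: midpoint_def)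
  have G: "integrable lborel G" "(LINT v|lborel. G v) = 0"
    unfolding G_def[abs_def] ab_eq integral_auto_wigner_reflect[OF f]
    by (rule integrable_auto_wigner_reflect[OF f]) (simp add: ab)
  have G_a: "G a \<noteq> 0" using ab by (simp add: G_def)
  have G_sup: "pi ^ DIM('a) * \<bar>G v\<bar> \<le> (LINT v|lborel. \<bar>G v\<bar>)" for v
    using auto_wigner_mult_le[OF f, of v "a + b - v"] by (simp add: G_def)
  have N [measurable]: "?N \<in> sets borel"
    by (intro borel_open open_auto_wigner_neg f)
  have N': "{v. a + b - v \<in> ?N} \<in> sets borel"
    by measurable
  have "2 * ennreal (pi ^ DIM('a) / 4) = ennreal (pi ^ DIM('a) / 2)"
    by (simp flip: ennreal_mult' ennreal_numeral)
  also have "\<dots> \<le> emeasure lborel {v \<in> space lborel. G v < 0}"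
    by (rule emeasure_negative_ge_if_sup_le_integral[OF G(1) _ _ G_sup G_a]) (simp_all add: G(2))
  also have "\<dots> \<le> emeasure lborel (?N \<union> {v. a + b - v \<in> ?N})"
    using N N' by (intro emeasure_mono) (auto simp: G_def mult_less_0_iff)
  also have "\<dots> \<le> emeasure lborel ?N + emeasure lborel {v. a + b - v \<in> ?N}"
    using N N' by (intro emeasure_subadditive) auto
  also have "\<dots> = 2 * emeasure lborel ?N"
    using emeasure_lborel_reflect[OF N(1), of "a + b"] by (simp add: mult_2)
  finally show ?thesis
    by (simp add: ennreal_mult_le_mult_iff)
qed

section \<open>The radius of a ball containing the negative set\<close>

lemma Re_wigner_eq_auto_wigner:
  fixes f :: "real^'n \<Rightarrow> complex"
  assumes "hbar > 0"
  shows "Re (wigner hbar f (x, p)) = (1 / (pi * hbar)) ^ CARD('n) * auto_wigner f (x, (2 / hbar) *\<^sub>R p)"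
proof -
  let ?w = "\<lambda>\<tau>. f (x + (1/2) *\<^sub>R \<tau>) * cnj (f (x - (1/2) *\<^sub>R \<tau>)) * exp (- \<i> * complex_of_real ((p \<bullet> \<tau>) / hbar))"
  have "(LINT \<tau>|lborel. ?w \<tau>) = 2 ^ CARD('n) *\<^sub>R (LINT t|lborel. ?w (0 + 2 *\<^sub>R t))"
    by (subst integral_lborel_affine[where c=2 and t=0]) simp_all
  also have "\<dots> = of_real (2 ^ CARD('n) * auto_wigner f (x, (2 / hbar) *\<^sub>R p))"
    unfolding of_real_mult cross_wigner_self[symmetric]
    by (simp add: cross_wigner_def fourier_def cis_conv_exp scaleR_conv_of_real[where 'a=complex])
  finally have "wigner hbar f (x, p)
    = of_real (1 / (2 * pi * hbar) ^ CARD('n) * (2 ^ CARD('n) * auto_wigner f (x, (2 / hbar) *\<^sub>R p)))"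
    by (simp add: wigner_def)
  then show ?thesis
    by (simp only: Re_complex_of_real) (simp add: power_mult_distrib power_divide)
qed

lemma neg_part_wigner_iff:
  assumes "hbar > 0"
  shows "(x, p) \<in> neg_part (wigner hbar f) \<longleftrightarrow> auto_wigner f (x, (2 / hbar) *\<^sub>R p) < 0"
  using assms by (simp add: neg_part_def Re_wigner_eq_auto_wigner mult_less_0_iff zero_less_power)

lemma emeasure_lborel_scale_snd:
  fixes S :: "('a::euclidean_space \<times> 'b::euclidean_space) set"
  assumes "S \<in> sets borel" and c: "c > 0"
  shows "emeasure lborel S = ennreal (c ^ DIM('b)) * emeasure lborel {(x, p). (x, c *\<^sub>R p) \<in> S}"
proof -
  let ?T = "{(x, p). (x, c *\<^sub>R p) \<in> S}"
  have S [measurable]: "S \<in> sets (borel \<Otimes>\<^sub>M borel)"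
    using assms(1) by (simp only: borel_prod)
  have "(\<lambda>(x, p). (x, c *\<^sub>R p)) -` S \<inter> space (borel \<Otimes>\<^sub>M borel) \<in> sets (borel \<Otimes>\<^sub>M borel)"
    by (rule measurable_sets[OF _ S]) measurable
  then have T [measurable]: "?T \<in> sets (borel \<Otimes>\<^sub>M borel)"
    by (simp add: vimage_def case_prod_unfold space_pair_measure)
  have fubini: "emeasure lborel A = (\<integral>\<^sup>+x. (\<integral>\<^sup>+p. indicator A (x, p) \<partial>lborel) \<partial>lborel)"
    if "A \<in> sets (borel \<Otimes>\<^sub>M borel)" for A :: "('a \<times> 'b) set"
    using lborel.emeasure_pair_measure[of A "lborel :: 'a measure"] that
    unfolding lborel_prod borel_prod by simp
  have scale: "(\<integral>\<^sup>+p. indicator S (x, p) \<partial>lborel) = ennreal (c ^ DIM('b)) * (\<integral>\<^sup>+p. indicator ?T (x, p) \<partial>lborel)" for x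
  proof -
    have "(\<lambda>p. indicator S (x, p) :: ennreal) \<in> borel_measurable borel" by measurable
    from nn_integral_lborel_affine[OF this, of c 0] c show ?thesis
      by (simp add: indicator_def)
  qed
  have "emeasure lborel S = (\<integral>\<^sup>+x. ennreal (c ^ DIM('b)) * (\<integral>\<^sup>+p. indicator ?T (x, p) \<partial>lborel) \<partial>lborel)"
    unfolding fubini[OF S] scale ..
  also have "\<dots> = ennreal (c ^ DIM('b)) * (\<integral>\<^sup>+x. (\<integral>\<^sup>+p. indicator ?T (x, p) \<partial>lborel) \<partial>lborel)"
    by (rule nn_integral_cmult) measurable
  finally show ?thesis
    unfolding fubini[OF T] .
qed

theorem emeasure_neg_part_wigner_ge:
  fixes f :: "real^'n \<Rightarrow> complex"
  assumes hbar: "hbar > 0" and f: "f \<in> L2" and nonempty: "neg_part (wigner hbar f) \<noteq> {}"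
  shows "ennreal ((hbar / 2 * pi) ^ CARD('n) / 4) \<le> emeasure lborel (neg_part (wigner hbar f))"
    (is "_ \<le> emeasure lborel ?N")
proof -
  have f': "square_integrable f"
    using f by (simp add: L2_def square_integrable_def)
  obtain x p where "(x, p) \<in> ?N"
    using nonempty by (metis equals0I surj_pair)
  then have neg: "auto_wigner f (x, (2 / hbar) *\<^sub>R p) < 0"
    using hbar by (simp add: neg_part_wigner_iff)
  have rescaled: "{(x, p). (x, (hbar / 2) *\<^sub>R p) \<in> ?N} = {z. auto_wigner f z < 0}"
    using hbar by (auto simp: neg_part_wigner_iff)
  have "?N = (\<lambda>z. (fst z, (2 / hbar) *\<^sub>R snd z)) -` {z. auto_wigner f z < 0}"
    using hbar by (auto simp: neg_part_wigner_iff)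
  also have "open \<dots>"
    by (intro open_vimage open_auto_wigner_neg f' continuous_intros)
  finally have N: "?N \<in> sets borel" by (rule borel_open)
  have "ennreal ((hbar / 2 * pi) ^ CARD('n) / 4) = ennreal ((hbar / 2) ^ CARD('n)) * ennreal (pi ^ CARD('n) / 4)"
    unfolding power_mult_distrib times_divide_eq_right[symmetric] using hbar by (intro ennreal_mult) simp_all
  also have "\<dots> \<le> ennreal ((hbar / 2) ^ CARD('n)) * emeasure lborel {z. auto_wigner f z < 0}"
    using emeasure_auto_wigner_neg_ge[OF f' neg] by (intro mult_left_mono) simp_all
  also have "\<dots> = emeasure lborel ?N"
    using emeasure_lborel_scale_snd[OF N, of "hbar / 2"] hbar by (simp add: rescaled)
  finally show ?thesis .
qed

lemma radius_ge_if_ball_volume_ge: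
  fixes c r :: real
  assumes n: "n > 0" and c: "c > 0" and r: "r > 0"
    and volume: "(c * pi) ^ n / 4 \<le> pi ^ n / fact n * r ^ (2 * n)"
  shows "r \<ge> (1 / 2) * sqrt (c * root n (fact n / 2))"
proof -
  have "pi ^ n * (c ^ n * fact n / 4) \<le> pi ^ n * (r\<^sup>2) ^ n"
    using volume unfolding power_mult[of r] power_mult_distrib[of c] by (simp add: field_simps)
  then have fact_le: "c ^ n * fact n / 4 \<le> (r\<^sup>2) ^ n"
    by (rule mult_left_le_imp_le) simp
  have "(c * root n (fact n / 2) / 4) ^ n = c ^ n * fact n / 4 * (2 / 4 ^ n)"
    using n by (simp add: power_mult_distrib power_divide real_root_pow_pos2)
  also have "\<dots> \<le> c ^ n * fact n / 4"
    using c n self_le_power[of "4::real" n] by (intro mult_right_le_one_le) simp_all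
  also note fact_le
  finally have "c * root n (fact n / 2) / 4 \<le> r\<^sup>2"
    using c n by (subst (asm) power_mono_iff) simp_all
  then have "sqrt (c * root n (fact n / 2) / 4) \<le> r"
    using r by (intro real_le_lsqrt) simp_all
  then show ?thesis
    by (simp add: real_sqrt_divide)
qed

theorem theorem4:
  fixes hbar :: real and f :: "real^'n \<Rightarrow> complex"
    and R0 :: real and z0 :: "(real^'n) \<times> (real^'n)"
  assumes "hbar > 0"
    and "f \<in> L2"
    and "neg_part (wigner hbar f) \<noteq> {}"
    and "R0 > 0"
    and "neg_part (wigner hbar f) \<subseteq> ball z0 R0"
  shows "R0 \<ge> (1/2) * sqrt ((hbar / 2) * root CARD('n) (fact CARD('n) / 2))"
proof (rule radius_ge_if_ball_volume_ge)
  have "ennreal ((hbar / 2 * pi) ^ CARD('n) / 4) \<le> emeasure lborel (neg_part (wigner hbar f))"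
    using assms(1-3) by (rule emeasure_neg_part_wigner_ge)
  also have "\<dots> \<le> emeasure lborel (ball z0 R0)"
    using assms(5) by (rule emeasure_mono) simp
  also have "\<dots> = ennreal (pi ^ CARD('n) / fact CARD('n) * R0 ^ (2 * CARD('n)))"
  proof -
    have dim: "DIM((real^'n) \<times> (real^'n)) = 2 * CARD('n)" by simp
    show ?thesis
      unfolding emeasure_ball[OF less_imp_le[OF assms(4)]] dim unit_ball_vol_even ..
  qed
  finally show "(hbar / 2 * pi) ^ CARD('n) / 4 \<le> pi ^ CARD('n) / fact CARD('n) * R0 ^ (2 * CARD('n))"
    using assms(4) by (simp add: ennreal_le_iff)
qed (use assms in simp_all)

end
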